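(* Let $\Omega\subset\mathbb{R}^n$ be a bounded, open, connected set with Lipschitz boundary, and let $W:\mathbb{R}^m\to\mathbb{R}$ be a nonnegative $C^1$ potential possessing several minima. Let $a\in\mathbb{R}^m$ be a global minimum of $W$ and let $r_0>0$ be fixed such that for every $w\in\mathbb{R}^m$ with $|w|=1$ the function $\lambda\mapsto W(a+\lambda w)$ is strictly increasing on $[0,r_0)$. Let $A\subset\Omega$ be an open, Lipschitz set with $\partial A\neq\varnothing$. Suppose that (1) $u\in W^{1,2}(\Omega)\cap C^1(\Omega)$, where $u:\Omega\to\mathbb{R}^m$; (2) $|u(x)-a|\le r$ on $\partial A\cap\Omega$, for some $r$ with $2r\in(0,r_0)$; (3) there is an $x_0\in A$ such that $|u(x_0)-a|>r$. Then there exists $\tilde u\in W^{1,2}(\Omega)$, with values in $\mathbb{R}^m$, such that \[ \tilde u(x)=u(x)\ \text{ in }\Omega\setminus A,\qquad |\tilde u(x)-a|\le r\ \text{ in } A,\qquad J_\Omega(\tilde u)<J_\Omega(u). \]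
   Context: For $v:\Omega\to\mathbb{R}^m$ in $W^{1,2}(\Omega)$ the functional is \[ J_\Omega(v)=\int_\Omega\left(\tfrac12|\nabla v|^2+W(v)\right)\mathrm{d}x , \] and $|\cdot|$ denotes the Euclidean norm.
   Formalization: The inclusion of A in Ω is taken to be proper (for A = Ω, u constant at another global minimum is a counterexample), and J_Ω(u) is assumed finite (otherwise infinite energy outside A, where ũ = u, makes strict decrease impossible). *)

theory Defs
  imports "HOL-Analysis.Analysis"
begin

(* Meant for open S, where continuous partial derivatives and total differentiability
   may be used interchangeably. *)
primrec Ck_on :: "nat \<Rightarrow> 'a::euclidean_space set \<Rightarrow> ('a \<Rightarrow> 'b::real_normed_vector) \<Rightarrow> bool" where
  "Ck_on 0 S f \<longleftrightarrow> continuous_on S f"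
| "Ck_on (Suc k) S f \<longleftrightarrow>
     (\<forall>x\<in>S. f differentiable at x) \<and>
     (\<forall>i\<in>Basis. Ck_on k S (\<lambda>x. frechet_derivative f (at x) i))"

definition test_function :: "'a::euclidean_space set \<Rightarrow> ('a \<Rightarrow> real) \<Rightarrow> bool" where
  "test_function S \<phi> \<longleftrightarrow>
     (\<forall>k. Ck_on k UNIV \<phi>) \<and> compact (closure {x. \<phi> x \<noteq> 0}) \<and> closure {x. \<phi> x \<noteq> 0} \<subseteq> S"

definition locally_integrable_on :: "('a::euclidean_space \<Rightarrow> 'b::euclidean_space) \<Rightarrow> 'a set \<Rightarrow> bool"
    (infix "locally'_integrable'_on" 50) where
  "f locally_integrable_on S \<longleftrightarrow> (\<forall>K. compact K \<and> K \<subseteq> S \<longrightarrow> set_integrable lebesgue K f)"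

definition square_integrable_on :: "('a::euclidean_space \<Rightarrow> 'b::euclidean_space) \<Rightarrow> 'a set \<Rightarrow> bool"
    (infix "square'_integrable'_on" 50) where
  "f square_integrable_on S \<longleftrightarrow>
     set_borel_measurable lebesgue S f \<and> set_integrable lebesgue S (\<lambda>x. (norm (f x))\<^sup>2)"

definition has_weak_partial ::
    "'a::euclidean_space set \<Rightarrow> 'a \<Rightarrow> ('a \<Rightarrow> 'b::euclidean_space) \<Rightarrow> ('a \<Rightarrow> 'b) \<Rightarrow> bool" where
  "has_weak_partial S i v g \<longleftrightarrow>
     v locally_integrable_on S \<and> g locally_integrable_on S \<and>
     (\<forall>\<phi>. test_function S \<phi> \<longrightarrow>
        (LINT x:S|lebesgue. frechet_derivative \<phi> (at x) i *\<^sub>R v x)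
          = - (LINT x:S|lebesgue. \<phi> x *\<^sub>R g x))"

definition sobolev_W12 :: "'a::euclidean_space set \<Rightarrow> ('a \<Rightarrow> 'b::euclidean_space) set" where
  "sobolev_W12 S =
     {v. v square_integrable_on S \<and>
         (\<forall>i\<in>Basis. \<exists>g. g square_integrable_on S \<and> has_weak_partial S i v g)}"

(* For open S the weak partial derivative is unique up to a null subset of S, and the
   energy below does not depend on the representative chosen. *)
definition weak_partial ::
    "'a::euclidean_space set \<Rightarrow> 'a \<Rightarrow> ('a \<Rightarrow> 'b::euclidean_space) \<Rightarrow> 'a \<Rightarrow> 'b" where
  "weak_partial S i v = (SOME g. has_weak_partial S i v g)"

(* The functional J, with values in [0,\<infinity>]; only meaningful for W \<ge> 0, since ennreal
   truncates negative reals to 0. The sum is the squared Euclidean (Frobenius) norm of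
   the weak gradient of v. *)
definition energy ::
    "('b::euclidean_space \<Rightarrow> real) \<Rightarrow> 'a::euclidean_space set \<Rightarrow> ('a \<Rightarrow> 'b) \<Rightarrow> ennreal" where
  "energy W S v =
     (\<integral>\<^sup>+x\<in>S. ennreal (1/2 * (\<Sum>i\<in>Basis. (norm (weak_partial S i v x))\<^sup>2) + W (v x)) \<partial>lebesgue)"

(* Near each boundary point S is the strict epigraph, in some direction e, of a Lipschitz
   function on the hyperplane orthogonal to e; x - (x \<bullet> e) *\<^sub>R e is the orthogonal projection
   of x to that hyperplane. *)
definition lipschitz_boundary :: "'a::euclidean_space set \<Rightarrow> bool" where
  "lipschitz_boundary S \<longleftrightarrow>
     (\<forall>p\<in>frontier S. \<exists>\<rho>>0. \<exists>e \<gamma> L.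
        norm e = 1 \<and> L-lipschitz_on {y. y \<bullet> e = 0} (\<gamma> :: 'a \<Rightarrow> real) \<and>
        S \<inter> ball p \<rho> = {x \<in> ball p \<rho>. \<gamma> (x - (x \<bullet> e) *\<^sub>R e) < x \<bullet> e})"

definition local_minimum :: "('a::topological_space \<Rightarrow> real) \<Rightarrow> 'a \<Rightarrow> bool" where
  "local_minimum W b \<longleftrightarrow> (\<forall>\<^sub>F w in nhds b. W b \<le> W w)"

end

theory Submission
  imports Defs
begin

text \<open>Fold the values of \<open>u\<close> on \<open>A\<close> radially around \<open>a\<close>: a value at distance \<open>\<rho>\<close> from \<open>a\<close> is moved along its ray
  to distance \<open>\<rho>\<close> if \<open>\<rho> \<le> r\<close>, to distance \<open>2 * r - \<rho>\<close> if \<open>r \<le> \<rho> \<le> 2 * r\<close>, and to \<open>a\<close> itself if \<open>2 * r \<le> \<rho>\<close>.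
  The fold is the identity for the values that \<open>u\<close> takes on \<open>frontier A \<inter> \<Omega>\<close>, so the folded map glues with
  \<open>u\<close> outside \<open>A\<close>. It is 1-Lipschitz, so the gradient does not grow, and it does not increase \<open>W\<close> because
  \<open>2 * r < r\<^sub>0\<close> and \<open>a\<close> is a global minimum. The potential decreases strictly where \<open>r < \<rho> < 2 * r\<close>; this open
  set meets \<open>A\<close>, since otherwise \<open>{x \<in> A. r < \<rho>}\<close> would be open and relatively closed in the connected set
  \<open>\<Omega>\<close>. The weak derivative of the folded map is obtained by dominated convergence from \<open>C\<^sup>1\<close> folds that are
  still the identity on a slightly larger ball, and the energies are compared through the almost everywhere
  uniqueness of weak derivatives.\<close>

section \<open>Radial folds\<close>

text \<open>For \<open>e > 0\<close> a \<open>C\<^sup>1\<close> approximation of the positive part that vanishes even for \<open>s \<le> e\<close>.\<close>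

definition ramp :: "real \<Rightarrow> real \<Rightarrow> real" where
  "ramp e s = ((max 0 (s - e))\<^sup>2 - (max 0 (s - 2 * e))\<^sup>2) / (2 * e)"

text \<open>For \<open>e > 0\<close> this is the continuous piecewise linear switch that rises from
  0 at \<open>e\<close> to 1 at \<open>2 * e\<close>.\<close>

definition ramp_deriv :: "real \<Rightarrow> real \<Rightarrow> real" where
  "ramp_deriv e s = (max 0 (s - e) - max 0 (s - 2 * e)) / e"

text \<open>Both branches have slope 0 at the origin; there the difference quotient is bounded by
  \<open>\<bar>h\<bar>\<close>.\<close>

lemma max_0_square_has_derivative:
  "((\<lambda>s::real. (max 0 s)\<^sup>2) has_real_derivative 2 * max 0 s) (at s)"
proof -
  consider "s < 0" | "s = 0" | "s > 0" by linarith
  then show ?thesis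
  proof cases
    case 1
    have "((\<lambda>s::real. 0) has_real_derivative 0) (at s)" by simp
    then have "((\<lambda>s::real. (max 0 s)\<^sup>2) has_real_derivative 0) (at s)"
      by (rule DERIV_cong_ev[THEN iffD1, rotated -1, OF _ refl _ refl])
        (use 1 eventually_nhds_in_open[of "{..<0}" s] in \<open>auto elim!: eventually_mono\<close>)
    then show ?thesis using 1 by simp
  next
    case 2
    have "((\<lambda>h::real. (max 0 h)\<^sup>2 / h) \<longlongrightarrow> 0) (at 0)"
    proof (rule Lim_null_comparison)
      show "\<forall>\<^sub>F h::real in at 0. norm ((max 0 h)\<^sup>2 / h) \<le> \<bar>h\<bar>"
        by (rule always_eventually) (auto simp: max_def power2_eq_square)
      show "((\<lambda>h::real. \<bar>h\<bar>) \<longlongrightarrow> 0) (at 0)" by (rule tendsto_eq_intros | simp)+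
    qed
    then show ?thesis using 2 by (simp add: DERIV_def)
  next
    case 3
    have "((\<lambda>s::real. s\<^sup>2) has_real_derivative 2 * s) (at s)"
      by (auto intro!: derivative_eq_intros)
    then have "((\<lambda>s::real. (max 0 s)\<^sup>2) has_real_derivative 2 * s) (at s)"
      by (rule DERIV_cong_ev[THEN iffD1, rotated -1, OF _ refl _ refl])
        (use 3 eventually_nhds_in_open[of "{0<..}" s] in \<open>auto elim!: eventually_mono\<close>)
    then show ?thesis using 3 by simp
  qed
qed

lemma ramp_has_derivative: "(ramp e has_real_derivative ramp_deriv e s) (at s)"
proof -
  have *: "((\<lambda>s. (max 0 (s - c))\<^sup>2) has_real_derivative 2 * max 0 (s - c)) (at s)" for c :: real
  proof -
    have "((\<lambda>s. s - c) has_real_derivative 1) (at s)" by (auto intro!: derivative_eq_intros)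
    from DERIV_chain2[OF max_0_square_has_derivative this] show ?thesis by simp
  qed
  \<comment> \<open>For \<open>e = 0\<close> both sides are 0, since division by zero yields
    0.\<close>
  have "(2 * p - 2 * q) / (2 * e) = (p - q) / e" for p q
    by (cases "e = 0") (simp_all add: field_simps)
  then have "(2 * max 0 (s - e) - 2 * max 0 (s - 2 * e)) / (2 * e) = ramp_deriv e s"
    by (simp only: ramp_deriv_def)
  then show ?thesis
    using DERIV_cdivide[OF DERIV_diff[OF *[of e] *[of "2 * e"]], of "2 * e"]
    by (simp add: ramp_def[abs_def])
qed

lemma ramp_eq_0: "0 < e \<Longrightarrow> s \<le> e \<Longrightarrow> ramp e s = 0"
  by (simp add: ramp_def)

lemma ramp_deriv_eq_0: "0 < e \<Longrightarrow> s \<le> e \<Longrightarrow> ramp_deriv e s = 0"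
  by (simp add: ramp_deriv_def)

text \<open>The loss \<open>3 / 2 * e\<close> is the integral of \<open>1 - ramp_deriv e\<close>
  over \<open>[0, 2 * e]\<close>: a full \<open>e\<close>, then half of \<open>e\<close> along the
  linear rise.\<close>

lemma ramp_large: "0 < e \<Longrightarrow> 2 * e \<le> s \<Longrightarrow> ramp e s = s - 3 / 2 * e"
  by (simp add: ramp_def power2_eq_square field_simps)

lemma ramp_deriv_eq_1: "0 < e \<Longrightarrow> 2 * e \<le> s \<Longrightarrow> ramp_deriv e s = 1"
  by (simp add: ramp_deriv_def field_simps)

lemma ramp_deriv_nonneg: "0 < e \<Longrightarrow> 0 \<le> ramp_deriv e s"
  by (auto simp: ramp_deriv_def max_def field_simps)

lemma ramp_deriv_le_1: "0 < e \<Longrightarrow> ramp_deriv e s \<le> 1"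
  by (auto simp: ramp_deriv_def max_def field_simps)

lemma ramp_deriv_mono: "0 < e \<Longrightarrow> s \<le> t \<Longrightarrow> ramp_deriv e s \<le> ramp_deriv e t"
  by (auto simp: ramp_deriv_def max_def field_simps)

lemma ramp_mono:
  assumes "0 < e" "s \<le> t"
  shows "ramp e s \<le> ramp e t"
  by (rule DERIV_nonneg_imp_nondecreasing[OF assms(2)])
    (use ramp_has_derivative ramp_deriv_nonneg[OF assms(1)] in blast)

lemma ramp_nonneg: "0 < e \<Longrightarrow> 0 \<le> ramp e s"
  using ramp_mono[of e "min s e" s] ramp_eq_0[of e "min s e"] by simp

lemma ramp_le:
  assumes "0 < e"
  shows "ramp e s \<le> max 0 s"
proof (cases "s \<le> 0")
  case True
  then show ?thesis using assms by (simp add: ramp_eq_0)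
next
  case False
  have "0 - ramp e 0 \<le> s - ramp e s"
    by (rule DERIV_nonneg_imp_nondecreasing[of 0 s "\<lambda>s. s - ramp e s"])
      (use False ramp_has_derivative ramp_deriv_le_1[OF assms] in
        \<open>auto intro!: exI[of _ "1 - ramp_deriv e _"] derivative_eq_intros\<close>)
  then show ?thesis using assms False by (simp add: ramp_eq_0)
qed

lemma eventually_at_right_0_less:
  "0 < c \<Longrightarrow> \<forall>\<^sub>F e in at_right (0::real). 0 < e \<and> e < c"
  by (auto simp: eventually_at_right_field)

lemma ramp_tendsto: "((\<lambda>e. ramp e s) \<longlongrightarrow> max 0 s) (at_right 0)"
proof (cases "s \<le> 0")
  case True
  have "\<forall>\<^sub>F e in at_right 0. ramp e s = 0"
    using eventually_at_right_0_less[of 1] by (rule eventually_mono) (use True in \<open>auto simp: ramp_eq_0\<close>)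
  then have "((\<lambda>e. ramp e s) \<longlongrightarrow> 0) (at_right 0)" by (rule tendsto_eventually)
  then show ?thesis using True by (simp only: max_absorb1)
next
  case False
  have "\<forall>\<^sub>F e in at_right 0. s - 3 / 2 * e = ramp e s"
    using eventually_at_right_0_less[of "s/2"] by (rule eventually_mono) (use False in \<open>auto simp: ramp_large\<close>)
  moreover have "((\<lambda>e. s - 3 / 2 * e) \<longlongrightarrow> max 0 s) (at_right 0)"
    using False by (auto intro!: tendsto_eq_intros)
  ultimately show ?thesis by (rule Lim_transform_eventually[rotated])
qed

text \<open>A fixed \<open>s\<close> is at most \<open>e\<close>, or at least \<open>2 * e\<close>,
  for all small \<open>e\<close>, so the value is eventually constant. The limit 0 at
  \<open>s = 0\<close> decides the values of \<open>sharp_slope\<close> at its jumps.\<close>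

lemma ramp_deriv_tendsto:
  "((\<lambda>e. ramp_deriv e s) \<longlongrightarrow> (if s \<le> 0 then 0 else 1)) (at_right 0)"
proof (rule tendsto_eventually, cases "s \<le> 0")
  case True
  show "\<forall>\<^sub>F e in at_right 0. ramp_deriv e s = (if s \<le> 0 then 0 else 1)"
    using eventually_at_right_0_less[of 1] by (rule eventually_mono) (use True in \<open>auto simp: ramp_deriv_eq_0\<close>)
next
  case False
  show "\<forall>\<^sub>F e in at_right 0. ramp_deriv e s = (if s \<le> 0 then 0 else 1)"
    using eventually_at_right_0_less[of "s/2"] by (rule eventually_mono) (use False in \<open>auto simp: ramp_deriv_eq_1\<close>)
qed

text \<open>The derivative at \<open>z\<close> of a radial map with tangential factor \<open>\<alpha>\<close> and radial factor \<open>\<beta>\<close>.\<close>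

definition radial_deriv :: "real \<Rightarrow> real \<Rightarrow> 'a \<Rightarrow> 'a \<Rightarrow> 'a::real_inner" where
  "radial_deriv \<alpha> \<beta> z q = \<alpha> *\<^sub>R q + ((\<beta> - \<alpha>) * (q \<bullet> sgn z)) *\<^sub>R sgn z"

text \<open>Split \<open>q\<close> into its component \<open>c\<close> along \<open>z\<close> and
  the orthogonal rest. The first is scaled by \<beta>, the second by \<alpha>, and the squares add
  up by Pythagoras.\<close>

lemma norm_radial_deriv_le:
  assumes "\<bar>\<alpha>\<bar> \<le> 1" "\<bar>\<beta>\<bar> \<le> 1"
  shows "norm (radial_deriv \<alpha> \<beta> z q) \<le> norm q"
proof (cases "z = 0")
  \<comment> \<open>\<open>sgn 0 = 0\<close>, so only the multiplication by \<alpha>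
    remains.\<close>
  case True
  then show ?thesis using assms by (simp add: radial_deriv_def mult_left_le_one_le)
next
  case False
  define n where "n = sgn z"
  define c where "c = q \<bullet> n"
  have n: "n \<bullet> n = 1" using False by (simp add: n_def norm_sgn dot_square_norm)
  have "(norm (radial_deriv \<alpha> \<beta> z q))\<^sup>2 = \<alpha>\<^sup>2 * (norm q)\<^sup>2 + (\<beta>\<^sup>2 - \<alpha>\<^sup>2) * c\<^sup>2"
    unfolding radial_deriv_def power2_norm_eq_inner n_def[symmetric] c_def
    by (simp add: inner_simps n inner_commute[of n q] power2_eq_square algebra_simps)
  also have "\<dots> = \<alpha>\<^sup>2 * ((norm q)\<^sup>2 - c\<^sup>2) + \<beta>\<^sup>2 * c\<^sup>2" by (simp add: algebra_simps)
  also have "\<dots> \<le> 1 * ((norm q)\<^sup>2 - c\<^sup>2) + 1 * c\<^sup>2"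
  proof (intro add_mono mult_right_mono)
    have "\<bar>c\<bar> \<le> norm q * norm n" unfolding c_def by (rule Cauchy_Schwarz_ineq2)
    then have "\<bar>c\<bar> \<le> norm q" using n by (simp add: norm_eq_sqrt_inner)
    then have "c\<^sup>2 \<le> (norm q)\<^sup>2" by (metis abs_le_square_iff abs_norm_cancel)
    then show "0 \<le> (norm q)\<^sup>2 - c\<^sup>2" by simp
  qed (use assms in \<open>auto simp: abs_square_le_1\<close>)
  finally show ?thesis by (simp add: power2_le_iff_abs_le)
qed

text \<open>\<open>sharp_fold r\<close> maps the sphere of radius \<open>\<rho>\<close> to the one of radius \<open>\<rho>\<close>, \<open>2 * r - \<rho>\<close> or \<open>0\<close>, for
  \<open>\<rho> \<le> r\<close>, \<open>r \<le> \<rho> \<le> 2 * r\<close> and \<open>2 * r \<le> \<rho>\<close>. It is the limit of \<open>smooth_fold r e\<close> as \<open>e\<close> tends to \<open>0\<close> from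
  above. At \<open>\<rho> = 0\<close> division by zero gives the intended value \<open>fold_scale r e 0 = 1\<close>.\<close>

definition fold_scale :: "real \<Rightarrow> real \<Rightarrow> real \<Rightarrow> real" where
  "fold_scale r e \<rho> = 1 - (2 * ramp e (\<rho> - r) - ramp e (\<rho> - 2 * r)) / \<rho>"

text \<open>The derivative of the radial profile \<open>\<rho> * fold_scale r e \<rho>\<close>,
  hence the signed stretching factor of the fold in radial direction.\<close>

definition fold_slope :: "real \<Rightarrow> real \<Rightarrow> real \<Rightarrow> real" where
  "fold_slope r e \<rho> = 1 - 2 * ramp_deriv e (\<rho> - r) + ramp_deriv e (\<rho> - 2 * r)"

definition smooth_fold :: "real \<Rightarrow> real \<Rightarrow> 'a \<Rightarrow> 'a::real_inner" where
  "smooth_fold r e z = fold_scale r e (norm z) *\<^sub>R z"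

definition smooth_fold_deriv :: "real \<Rightarrow> real \<Rightarrow> 'a \<Rightarrow> 'a \<Rightarrow> 'a::real_inner" where
  "smooth_fold_deriv r e z =
     radial_deriv (fold_scale r e (norm z)) (fold_slope r e (norm z)) z"

definition sharp_scale :: "real \<Rightarrow> real \<Rightarrow> real" where
  "sharp_scale r \<rho> = (if \<rho> \<le> r then 1 else if \<rho> \<le> 2 * r then (2 * r - \<rho>) / \<rho> else 0)"

text \<open>At the kinks \<open>r\<close> and \<open>2 * r\<close> of the profile the left slope is
  taken, which is the pointwise limit of \<open>fold_slope\<close>.\<close>

definition sharp_slope :: "real \<Rightarrow> real \<Rightarrow> real" where
  "sharp_slope r \<rho> = (if \<rho> \<le> r then 1 else if \<rho> \<le> 2 * r then - 1 else 0)"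

definition sharp_fold :: "real \<Rightarrow> 'a \<Rightarrow> 'a::real_inner" where
  "sharp_fold r z = sharp_scale r (norm z) *\<^sub>R z"

definition sharp_fold_deriv :: "real \<Rightarrow> 'a \<Rightarrow> 'a \<Rightarrow> 'a::real_inner" where
  "sharp_fold_deriv r z = radial_deriv (sharp_scale r (norm z)) (sharp_slope r (norm z)) z"

lemma fold_scale_eq_1: "0 < e \<Longrightarrow> 0 < r \<Longrightarrow> \<rho> \<le> r + e \<Longrightarrow> fold_scale r e \<rho> = 1"
  by (simp add: fold_scale_def ramp_eq_0)

lemma fold_slope_eq_1: "0 < e \<Longrightarrow> 0 < r \<Longrightarrow> \<rho> \<le> r + e \<Longrightarrow> fold_slope r e \<rho> = 1"
  by (simp add: fold_slope_def ramp_deriv_eq_0)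

text \<open>With \<open>p\<close> and \<open>q\<close> for the values of \<open>ramp_deriv e\<close>
  at \<open>\<rho> - r\<close> and \<open>\<rho> - 2 * r\<close>, monotonicity gives
  \<open>0 \<le> q \<le> p \<le> 1\<close>, so \<open>1 - 2 * p + q\<close> lies between -1 and
  1.\<close>

lemma abs_fold_slope_le_1:
  assumes "0 < e" "0 < r"
  shows "\<bar>fold_slope r e \<rho>\<bar> \<le> 1"
  using ramp_deriv_nonneg[OF assms(1), of "\<rho> - 2 * r"] ramp_deriv_le_1[OF assms(1), of "\<rho> - r"]
    ramp_deriv_mono[OF assms(1), of "\<rho> - 2 * r" "\<rho> - r"] assms
  unfolding fold_slope_def by (simp add: abs_le_iff)

lemma abs_fold_scale_le_1:
  assumes "0 < e" "0 < r" "0 \<le> \<rho>"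
  shows "\<bar>fold_scale r e \<rho>\<bar> \<le> 1"
proof -
  define d where "d = 2 * ramp e (\<rho> - r) - ramp e (\<rho> - 2 * r)"
  have "0 \<le> d" "d \<le> 2 * \<rho>"
    using ramp_nonneg[OF assms(1), of "\<rho> - 2 * r"] ramp_nonneg[OF assms(1), of "\<rho> - r"]
      ramp_le[OF assms(1), of "\<rho> - r"]
      ramp_mono[OF assms(1), of "\<rho> - 2 * r" "\<rho> - r"] assms
    unfolding d_def by linarith+
  \<comment> \<open>This includes \<open>\<rho> = 0\<close>, where the quotient is 0 by
    convention.\<close>
  then have "0 \<le> d / \<rho>" "d / \<rho> \<le> 2" using assms by (auto simp: divide_le_eq)
  then show ?thesis by (simp add: fold_scale_def d_def[symmetric] abs_le_iff)
qed

text \<open>The profile \<open>\<rho> * fold_scale r e \<rho>\<close> has derivative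
  \<open>fold_slope r e \<rho>\<close>; solving the product rule for the derivative of the scale
  gives this quotient.\<close>

lemma fold_scale_has_derivative:
  assumes "\<rho> \<noteq> 0"
  shows "(fold_scale r e has_real_derivative (fold_slope r e \<rho> - fold_scale r e \<rho>) / \<rho>) (at \<rho>)"
proof -
  have *: "((\<lambda>\<rho>. ramp e (\<rho> - c)) has_real_derivative ramp_deriv e (\<rho> - c)) (at \<rho>)" for c
  proof -
    have "((\<lambda>\<rho>. \<rho> - c) has_real_derivative 1) (at \<rho>)" by (auto intro!: derivative_eq_intros)
    from DERIV_chain2[OF ramp_has_derivative this] show ?thesis by simp
  qed
  define N where "N = (\<lambda>\<rho>. 2 * ramp e (\<rho> - r) - ramp e (\<rho> - 2 * r))"
  define N' where "N' = 2 * ramp_deriv e (\<rho> - r) - ramp_deriv e (\<rho> - 2 * r)"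
  have "(N has_real_derivative N') (at \<rho>)"
    unfolding N_def N'_def by (intro DERIV_diff DERIV_cmult *)
  then have "((\<lambda>\<rho>. 1 - N \<rho> / \<rho>) has_real_derivative
      0 - (N' * \<rho> - N \<rho> * 1) / (\<rho> * \<rho>)) (at \<rho>)"
    by (intro DERIV_diff DERIV_const DERIV_divide DERIV_ident assms)
  moreover have "0 - (N' * \<rho> - N \<rho> * 1) / (\<rho> * \<rho>) = ((1 - N') - (1 - N \<rho> / \<rho>)) / \<rho>"
    using assms by (simp add: divide_simps) (simp add: algebra_simps)
  ultimately show ?thesis
    by (simp add: fold_scale_def[abs_def] fold_slope_def N_def N'_def algebra_simps)
qed

lemma smooth_fold_near_0:
  "0 < e \<Longrightarrow> 0 < r \<Longrightarrow> norm z \<le> r + e \<Longrightarrow> smooth_fold r e z = z"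
  by (simp add: smooth_fold_def fold_scale_eq_1)

lemma smooth_fold_deriv_near_0:
  "0 < e \<Longrightarrow> 0 < r \<Longrightarrow> norm z \<le> r + e \<Longrightarrow> smooth_fold_deriv r e z q = q"
  by (simp add: smooth_fold_deriv_def radial_deriv_def fold_scale_eq_1 fold_slope_eq_1)

text \<open>The norm is not differentiable at 0, but the fold is the identity on a ball around 0.
  Elsewhere the chain and product rules apply.\<close>

lemma smooth_fold_has_derivative:
  assumes "0 < e" "0 < r"
  shows "(smooth_fold r e has_derivative smooth_fold_deriv r e z) (at z)"
proof (cases "z = 0")
  case True
  have "smooth_fold_deriv r e z = (\<lambda>q. q)"
    using True assms by (intro ext smooth_fold_deriv_near_0) auto
  moreover have "(smooth_fold r e has_derivative (\<lambda>q. q)) (at z)"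
  proof (rule has_derivative_transform_within_open[OF has_derivative_ident])
    show "open (ball (0::'a) (r + e))" by simp
  qed (use True assms in \<open>auto simp: smooth_fold_near_0\<close>)
  ultimately show ?thesis by simp
next
  case False
  have 1: "(norm has_derivative (\<lambda>q. sgn z \<bullet> q)) (at z)"
    using has_derivative_norm[OF False] by (simp add: inner_commute)
  have 2: "(fold_scale r e has_derivative
      (*) ((fold_slope r e (norm z) - fold_scale r e (norm z)) / norm z)) (at (norm z))"
    using fold_scale_has_derivative[of "norm z" r e] False
    by (simp add: has_field_derivative_def)
  have 3: "((\<lambda>z. fold_scale r e (norm z)) has_derivative
      (\<lambda>q. (fold_slope r e (norm z) - fold_scale r e (norm z)) / norm z * (sgn z \<bullet> q))) (at z)"
    using diff_chain_at[OF 1 2] by (simp add: o_def)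
  have 4: "(smooth_fold r e has_derivative
     (\<lambda>q. fold_scale r e (norm z) *\<^sub>R q +
       ((fold_slope r e (norm z) - fold_scale r e (norm z)) / norm z * (sgn z \<bullet> q)) *\<^sub>R z)) (at z)"
    unfolding smooth_fold_def[abs_def] by (rule has_derivative_scaleR[OF 3 has_derivative_ident])
  \<comment> \<open>Absorbing \<open>1 / norm z\<close> into \<open>z\<close> brings the chain rule
    term into the \<open>sgn z\<close> form of \<open>radial_deriv\<close>.\<close>
  have "(c / norm z * (sgn z \<bullet> q)) *\<^sub>R z = (c * (q \<bullet> sgn z)) *\<^sub>R sgn z" for c q
    by (simp add: sgn_div_norm inner_commute divide_inverse mult_ac)
  then show ?thesis
    using 4 by (simp only: smooth_fold_deriv_def radial_deriv_def[abs_def])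
qed

lemma norm_smooth_fold_le:
  "0 < e \<Longrightarrow> 0 < r \<Longrightarrow> norm (smooth_fold r e z) \<le> norm z"
  by (simp add: smooth_fold_def mult_left_le_one_le abs_fold_scale_le_1)

lemma norm_smooth_fold_deriv_le:
  "0 < e \<Longrightarrow> 0 < r \<Longrightarrow> norm (smooth_fold_deriv r e z q) \<le> norm q"
  unfolding smooth_fold_deriv_def
  by (intro norm_radial_deriv_le abs_fold_scale_le_1 abs_fold_slope_le_1) auto

lemma continuous_on_ramp_deriv: "continuous_on S (ramp_deriv e)"
  by (cases "e = 0") (auto simp: ramp_deriv_def[abs_def] intro!: continuous_intros)

text \<open>The formula contains \<open>sgn\<close>, which jumps at 0. Hence \<open>S\<close> is
  covered by two open sets: on \<open>P\<close> the fold derivative is the identity, on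
  \<open>Q\<close> the map \<open>w\<close> has no zero.\<close>

lemma continuous_on_smooth_fold_deriv:
  fixes w q :: "'a::topological_space \<Rightarrow> 'b::real_inner"
  assumes e: "0 < e" "0 < r" and S: "open S" and w: "continuous_on S w" and q: "continuous_on S q"
  shows "continuous_on S (\<lambda>x. smooth_fold_deriv r e (w x) (q x))"
proof -
  define P where "P = S \<inter> w -` ball 0 (r + e)"
  define Q where "Q = S \<inter> w -` (- {0})"
  have "open P" "open Q"
    unfolding P_def Q_def
    by (rule continuous_open_preimage[OF w S]; simp add: open_Compl)+
  moreover have "S = P \<union> Q" using e by (auto simp: P_def Q_def)
  moreover have "continuous_on P (\<lambda>x. smooth_fold_deriv r e (w x) (q x))"
  proof (rule continuous_on_eq)
    show "continuous_on P q" using q by (rule continuous_on_subset) (auto simp: P_def)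
  qed (use e in \<open>auto simp: P_def smooth_fold_deriv_near_0\<close>)
  moreover have "continuous_on Q (\<lambda>x. smooth_fold_deriv r e (w x) (q x))"
  proof -
    have w': "continuous_on Q w" and q': "continuous_on Q q"
      using w q by (auto simp: Q_def elim: continuous_on_subset)
    have nz: "w x \<noteq> 0" if "x \<in> Q" for x using that by (auto simp: Q_def)
    have "continuous_on Q (\<lambda>x. sgn (w x))"
      unfolding sgn_div_norm by (intro continuous_intros w') (use nz in auto)
    moreover have "continuous_on Q (\<lambda>x. fold_slope r e (norm (w x)))"
      unfolding fold_slope_def
      by (intro continuous_intros continuous_on_compose2[OF continuous_on_ramp_deriv[of UNIV e]] w') auto
    moreover have "continuous_on UNIV (ramp e)"
      using ramp_has_derivative by (auto intro!: continuous_at_imp_continuous_on DERIV_isCont)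
    then have "continuous_on Q (\<lambda>x. fold_scale r e (norm (w x)))"
      unfolding fold_scale_def
      by (intro continuous_intros continuous_on_compose2[of UNIV "ramp e" Q] w') (use nz in auto)
    ultimately show ?thesis
      unfolding smooth_fold_deriv_def radial_deriv_def
      by (intro continuous_intros q' w') (use nz in auto)
  qed
  ultimately show ?thesis using continuous_on_open_Un by metis
qed

lemma fold_scale_tendsto:
  assumes "0 < r"
  shows "((\<lambda>e. fold_scale r e \<rho>) \<longlongrightarrow> sharp_scale r \<rho>) (at_right 0)"
proof -
  have "((\<lambda>e. fold_scale r e \<rho>) \<longlongrightarrow> 1 - (2 * max 0 (\<rho> - r) - max 0 (\<rho> - 2 * r)) / \<rho>) (at_right 0)"
    unfolding fold_scale_def divide_inverse by (intro tendsto_intros ramp_tendsto)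
  moreover have "1 - (2 * max 0 (\<rho> - r) - max 0 (\<rho> - 2 * r)) / \<rho> = sharp_scale r \<rho>"
    using assms by (auto simp: sharp_scale_def max_def field_simps)
  ultimately show ?thesis by simp
qed

lemma fold_slope_tendsto:
  assumes "0 < r"
  shows "((\<lambda>e. fold_slope r e \<rho>) \<longlongrightarrow> sharp_slope r \<rho>) (at_right 0)"
proof -
  have "((\<lambda>e. fold_slope r e \<rho>) \<longlongrightarrow>
      1 - 2 * (if \<rho> - r \<le> 0 then 0 else 1) + (if \<rho> - 2 * r \<le> 0 then 0 else 1)) (at_right 0)"
    unfolding fold_slope_def by (intro tendsto_intros ramp_deriv_tendsto)
  moreover have "1 - 2 * (if \<rho> - r \<le> 0 then 0 else 1) + (if \<rho> - 2 * r \<le> 0 then 0 else 1)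
      = sharp_slope r \<rho>"
    using assms by (auto simp: sharp_slope_def)
  ultimately show ?thesis by simp
qed

lemma smooth_fold_tendsto:
  "0 < r \<Longrightarrow> ((\<lambda>e. smooth_fold r e z) \<longlongrightarrow> sharp_fold r z) (at_right 0)"
  unfolding smooth_fold_def sharp_fold_def by (intro tendsto_intros fold_scale_tendsto)

lemma smooth_fold_deriv_tendsto:
  "0 < r \<Longrightarrow> ((\<lambda>e. smooth_fold_deriv r e z q) \<longlongrightarrow> sharp_fold_deriv r z q) (at_right 0)"
  unfolding smooth_fold_deriv_def sharp_fold_deriv_def radial_deriv_def
  by (intro tendsto_intros fold_scale_tendsto fold_slope_tendsto)

text \<open>Infinitesimal form of the fold being 1-Lipschitz; applied to each partial derivative of
  \<open>u\<close> it controls the gradient term of the energy.\<close>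

lemma norm_sharp_fold_deriv_le:
  assumes "0 < r"
  shows "norm (sharp_fold_deriv r z q) \<le> norm q"
  unfolding sharp_fold_deriv_def
  by (rule norm_radial_deriv_le)
    (use assms in \<open>auto simp: sharp_scale_def sharp_slope_def abs_le_iff divide_le_eq le_divide_eq\<close>)

lemma norm_sharp_fold_le:
  assumes "0 < r"
  shows "norm (sharp_fold r z) \<le> r"
  using assms by (auto simp: sharp_fold_def sharp_scale_def)

section \<open>Smooth bump functions\<close>

lemma Ck_on_Suc_UNIV_I:
  assumes "\<And>x. (f has_derivative f' x) (at x)"
    and "\<And>i. i \<in> Basis \<Longrightarrow> Ck_on k UNIV (\<lambda>x. f' x i)"
  shows "Ck_on (Suc k) UNIV f"
proof -
  have "frechet_derivative f (at x) = f' x" for x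
    by (rule frechet_derivative_at[OF assms(1), symmetric])
  then show ?thesis using assms by (auto simp: differentiable_def)
qed

lemma Ck_on_const: "Ck_on k UNIV (\<lambda>x. c)"
  by (induction k arbitrary: c) (auto intro: Ck_on_Suc_UNIV_I[where f' = "\<lambda>x h. 0"])

text \<open>Differentiability supplies the continuity at the bottom level, and the partial
  derivatives are lowered by induction. The product rule needs this for its undifferentiated
  factors.\<close>

lemma Ck_on_Suc_imp_Ck_on: "Ck_on (Suc k) UNIV f \<Longrightarrow> Ck_on k UNIV f"
proof (induction k arbitrary: f)
  case 0
  then show ?case
    by (auto intro!: continuous_at_imp_continuous_on differentiable_imp_continuous_within)
next
  case (Suc k)
  have "Ck_on (Suc k) UNIV (\<lambda>x. frechet_derivative f (at x) i)" if "i \<in> Basis" for i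
    using Suc.prems that Ck_on.simps(2)[of "Suc k" UNIV f] by blast
  then show ?case using Suc.IH Suc.prems Ck_on.simps(2)[of k UNIV f] Ck_on.simps(2)[of "Suc k" UNIV f]
    by blast
qed

lemma Ck_on_UNIV_SucD:
  assumes "Ck_on (Suc k) UNIV f"
  shows "(f has_derivative frechet_derivative f (at x)) (at x)"
    and "i \<in> Basis \<Longrightarrow> Ck_on k UNIV (\<lambda>x. frechet_derivative f (at x) i)"
  using assms by (auto simp: frechet_derivative_works)

lemma Ck_on_add: "Ck_on k UNIV f \<Longrightarrow> Ck_on k UNIV g \<Longrightarrow> Ck_on k UNIV (\<lambda>x. f x + g x)"
proof (induction k arbitrary: f g)
  case 0
  then show ?case by (auto intro: continuous_intros)
next
  case (Suc k)
  note D = Ck_on_UNIV_SucD[OF Suc.prems(1)] Ck_on_UNIV_SucD[OF Suc.prems(2)]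
  show ?case
    by (rule Ck_on_Suc_UNIV_I[OF has_derivative_add[OF D(1) D(3)]]) (intro Suc.IH D(2) D(4))
qed

lemma Ck_on_mult:
  fixes f g :: "'a::euclidean_space \<Rightarrow> real"
  shows "Ck_on k UNIV f \<Longrightarrow> Ck_on k UNIV g \<Longrightarrow> Ck_on k UNIV (\<lambda>x. f x * g x)"
proof (induction k arbitrary: f g)
  case 0
  then show ?case by (auto intro: continuous_intros)
next
  case (Suc k)
  note D = Ck_on_UNIV_SucD[OF Suc.prems(1)] Ck_on_UNIV_SucD[OF Suc.prems(2)]
  show ?case
    by (rule Ck_on_Suc_UNIV_I[OF has_derivative_mult[OF D(1) D(3)]])
      (intro Ck_on_add Suc.IH D(2) D(4) Suc.prems[THEN Ck_on_Suc_imp_Ck_on])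
qed

lemma Ck_on_prod:
  fixes f :: "'i \<Rightarrow> 'a::euclidean_space \<Rightarrow> real"
  assumes "finite I" "\<And>i. i \<in> I \<Longrightarrow> Ck_on k UNIV (f i)"
  shows "Ck_on k UNIV (\<lambda>x. \<Prod>i\<in>I. f i x)"
  using assms by (induction I rule: finite_induct) (auto intro: Ck_on_const Ck_on_mult)

section \<open>Flat functions and smooth bumps on boxes\<close>

text \<open>The polynomial factor makes the family closed under differentiation, so smoothness of
  the classical \<open>exp (- 1 / t)\<close> follows by induction.\<close>

definition flat_exp :: "real poly \<Rightarrow> real \<Rightarrow> real" where
  "flat_exp p t = (if t \<le> 0 then 0 else poly p (1 / t) * exp (- 1 / t))"

lemma poly_times_exp_minus_tendsto_0:
  fixes p :: "real poly"
  shows "((\<lambda>s. poly p s * exp (- s)) \<longlongrightarrow> 0) at_top"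
proof -
  have "((\<lambda>s. \<Sum>i\<le>degree p. coeff p i * (s ^ i / exp s)) \<longlongrightarrow> (\<Sum>i\<le>degree p. coeff p i * 0)) at_top"
    by (intro tendsto_intros tendsto_power_div_exp_0)
  then show ?thesis
    by (simp add: poly_altdef sum_divide_distrib exp_minus field_simps)
qed

text \<open>\<open>[:0, 0, 1:]\<close> is the square of the variable: it is evaluated at
  \<open>1 / t\<close> and so accounts for the factor \<open>1 / t^2\<close> produced by the chain
  rule.\<close>

lemma flat_exp_has_derivative:
  "(flat_exp p has_real_derivative flat_exp ([:0, 0, 1:] * (p - pderiv p)) t) (at t)"
proof -
  consider "t < 0" | "t = 0" | "t > 0" by linarith
  then show ?thesis
  proof cases
    case 1
    have "(flat_exp p has_real_derivative 0) (at t)"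
    proof (rule has_field_derivative_transform_within_open[where S = "{..<0}"])
      show "((\<lambda>t. 0) has_real_derivative 0) (at t)" by simp
    qed (use 1 in \<open>auto simp: flat_exp_def\<close>)
    then show ?thesis using 1 by (simp add: flat_exp_def)
  next
    case 2
    have "((\<lambda>h. flat_exp p h / h) \<longlongrightarrow> 0) (at 0)"
    proof (rule filterlim_split_at)
      show "((\<lambda>h. flat_exp p h / h) \<longlongrightarrow> 0) (at_left 0)"
        by (rule tendsto_eventually) (auto simp: flat_exp_def eventually_at_filter)
      \<comment> \<open>The difference quotient at 0 is again a polynomial in \<open>1 / h\<close>
        times \<open>exp (- 1 / h)\<close>; the substitution \<open>s = 1 / h\<close> sends it to
        infinity.\<close>
      have "((\<lambda>h. poly ([:0, 1:] * p) (inverse h) * exp (- inverse h)) \<longlongrightarrow> 0) (at_right 0)"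
        by (rule filterlim_compose[OF poly_times_exp_minus_tendsto_0 filterlim_inverse_at_top_right])
      moreover have "\<forall>\<^sub>F h in at_right 0.
          poly ([:0, 1:] * p) (inverse h) * exp (- inverse h) = flat_exp p h / h"
        by (auto simp: flat_exp_def eventually_at_filter field_simps)
      ultimately show "((\<lambda>h. flat_exp p h / h) \<longlongrightarrow> 0) (at_right 0)"
        by (rule Lim_transform_eventually)
    qed
    then show ?thesis using 2 by (simp add: DERIV_def flat_exp_def)
  next
    case 3
    have "((\<lambda>t. 1 / t) has_real_derivative - (1 / t\<^sup>2)) (at t)"
      using 3 by (auto intro!: derivative_eq_intros simp: power2_eq_square)
    then have "((\<lambda>t. poly p (1 / t) * exp (- (1 / t))) has_real_derivative
        poly (pderiv p) (1 / t) * - (1 / t\<^sup>2) * exp (- (1 / t)) +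
        exp (- (1 / t)) * (- (- (1 / t\<^sup>2))) * poly p (1 / t)) (at t)"
      by (intro DERIV_mult DERIV_chain2[OF poly_DERIV] DERIV_chain2[OF DERIV_exp] DERIV_minus)
    moreover have "poly (pderiv p) (1 / t) * - (1 / t\<^sup>2) * exp (- (1 / t)) +
        exp (- (1 / t)) * (- (- (1 / t\<^sup>2))) * poly p (1 / t)
        = flat_exp ([:0, 0, 1:] * (p - pderiv p)) t"
      using 3 by (simp add: flat_exp_def power2_eq_square algebra_simps)
    ultimately have "((\<lambda>t. poly p (1 / t) * exp (- (1 / t))) has_real_derivative
        flat_exp ([:0, 0, 1:] * (p - pderiv p)) t) (at t)" by simp
    then show ?thesis
    proof (rule has_field_derivative_transform_within_open[where S = "{0<..}"])
      show "\<And>x. x \<in> {0<..} \<Longrightarrow> poly p (1 / x) * exp (- (1 / x)) = flat_exp p x"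
        by (auto simp: flat_exp_def)
    qed (use 3 in auto)
  qed
qed

text \<open>The induction is over all \<open>p\<close> at once, since differentiating changes
  \<open>p\<close>. The affine argument is kept general enough for both kinds of factor in
  \<open>box_bump\<close>.\<close>

lemma Ck_on_flat_exp: "Ck_on k UNIV (\<lambda>x. flat_exp p (c * (x \<bullet> i) + d))"
proof (induction k arbitrary: p)
  case 0
  have "isCont (flat_exp p) t" for t using flat_exp_has_derivative DERIV_isCont by blast
  then have "continuous_on UNIV (flat_exp p)" by (auto intro: continuous_at_imp_continuous_on)
  then show ?case by (auto intro!: continuous_on_compose2[of UNIV "flat_exp p"] continuous_intros)
next
  case (Suc k)
  show ?case
  proof (rule Ck_on_Suc_UNIV_I)
    fix x :: 'a
    have "(flat_exp p has_derivative (*) (flat_exp ([:0, 0, 1:] * (p - pderiv p)) (c * (x \<bullet> i) + d)))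
      (at (c * (x \<bullet> i) + d))"
      using flat_exp_has_derivative by (simp add: has_field_derivative_def)
    moreover have "((\<lambda>x. c * (x \<bullet> i) + d) has_derivative (\<lambda>h. c * (h \<bullet> i))) (at x)"
      by (auto intro!: derivative_eq_intros)
    ultimately show "((\<lambda>x. flat_exp p (c * (x \<bullet> i) + d)) has_derivative
       (\<lambda>h. flat_exp ([:0, 0, 1:] * (p - pderiv p)) (c * (x \<bullet> i) + d) * (c * (h \<bullet> i)))) (at x)"
      using diff_chain_at[of "\<lambda>x. c * (x \<bullet> i) + d"] by (auto simp: o_def)
  qed (intro Ck_on_mult Ck_on_const Suc.IH)
qed

lemma flat_exp_1_bounds: "0 \<le> flat_exp 1 t" "flat_exp 1 t \<le> 1"
  by (auto simp: flat_exp_def)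

text \<open>In each coordinate one factor is positive to the right of \<open>c\<close>, the other to
  the left of \<open>d\<close>. The multiplier \<open>Suc n\<close> steepens the edges, so the
  products tend to the indicator of the open box.\<close>

definition box_bump :: "nat \<Rightarrow> 'a \<Rightarrow> 'a \<Rightarrow> 'a::euclidean_space \<Rightarrow> real" where
  "box_bump n c d x = (\<Prod>i\<in>Basis.
     flat_exp 1 (real (Suc n) * (x \<bullet> i) + - (real (Suc n) * (c \<bullet> i))) *
     flat_exp 1 (- real (Suc n) * (x \<bullet> i) + real (Suc n) * (d \<bullet> i)))"

lemma Ck_on_box_bump: "Ck_on k UNIV (box_bump n c d)"
  unfolding box_bump_def[abs_def] by (intro Ck_on_prod Ck_on_mult Ck_on_flat_exp) auto

lemma box_bump_bounds: "0 \<le> box_bump n c d x" "box_bump n c d x \<le> 1"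
  unfolding box_bump_def
  by (auto intro!: prod_nonneg prod_le_1 mult_nonneg_nonneg mult_le_one flat_exp_1_bounds)

lemma box_bump_eq_0:
  assumes "x \<notin> box c d"
  shows "box_bump n c d x = 0"
proof -
  obtain i where i: "i \<in> Basis" "\<not> (c \<bullet> i < x \<bullet> i \<and> x \<bullet> i < d \<bullet> i)"
    using assms by (auto simp: mem_box)
  then have "real (Suc n) * (x \<bullet> i) + - (real (Suc n) * (c \<bullet> i)) \<le> 0
      \<or> - real (Suc n) * (x \<bullet> i) + real (Suc n) * (d \<bullet> i) \<le> 0"
    using mult_left_mono[of "x \<bullet> i" "c \<bullet> i" "real (Suc n)"]
      mult_left_mono[of "d \<bullet> i" "x \<bullet> i" "real (Suc n)"] by linarith
  then show ?thesis
    unfolding box_bump_def using i(1) by (auto simp: flat_exp_def intro!: prod_zero)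
qed

lemma test_function_box_bump:
  assumes "cbox c d \<subseteq> S"
  shows "test_function S (box_bump n c d)"
proof -
  have "{x. box_bump n c d x \<noteq> 0} \<subseteq> cbox c d"
    using box_bump_eq_0 box_subset_cbox by blast
  then have sub: "closure {x. box_bump n c d x \<noteq> 0} \<subseteq> cbox c d"
    by (rule closure_minimal) (rule closed_cbox)
  then have "compact (closure {x. box_bump n c d x \<noteq> 0})"
    using bounded_subset[OF bounded_cbox \<open>{x. box_bump n c d x \<noteq> 0} \<subseteq> cbox c d\<close>]
    by (simp only: compact_closure)
  then show ?thesis using sub assms Ck_on_box_bump by (auto simp: test_function_def)
qed

lemma flat_exp_1_scaled_tendsto:
  assumes "0 < t"
  shows "(\<lambda>n. flat_exp 1 (real (Suc n) * t)) \<longlonglongrightarrow> 1"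
proof -
  have "(\<lambda>n. exp (- (inverse (real (Suc n)) * inverse t))) \<longlonglongrightarrow> exp (- (0 * inverse t))"
    by (intro tendsto_intros LIMSEQ_inverse_real_of_nat)
  moreover have "exp (- (inverse (real (Suc n)) * inverse t)) = flat_exp 1 (real (Suc n) * t)" for n
  proof -
    have "0 < real (Suc n) * t" using assms by (intro mult_pos_pos) auto
    then have "flat_exp 1 (real (Suc n) * t) = exp (- 1 / (real (Suc n) * t))"
      by (simp only: flat_exp_def poly_1 mult_1 not_less[symmetric] not_not if_False if_True
          simp_thms)
    then show ?thesis using assms by (simp add: divide_inverse inverse_mult_distrib)
  qed
  ultimately show ?thesis by simp
qed

lemma box_bump_tendsto: "(\<lambda>n. box_bump n c d x) \<longlonglongrightarrow> indicator (box c d) x"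
proof (cases "x \<in> box c d")
  case True
  have "(\<lambda>n. box_bump n c d x) \<longlonglongrightarrow> (\<Prod>i\<in>(Basis::'a set). 1 * 1)"
    unfolding box_bump_def
  proof (intro tendsto_intros)
    fix i :: 'a assume "i \<in> Basis"
    then have i: "0 < x \<bullet> i - c \<bullet> i" "0 < d \<bullet> i - x \<bullet> i" using True by (auto simp: mem_box)
    have eq: "real (Suc n) * (x \<bullet> i) + - (real (Suc n) * (c \<bullet> i)) = real (Suc n) * (x \<bullet> i - c \<bullet> i)"
      "- real (Suc n) * (x \<bullet> i) + real (Suc n) * (d \<bullet> i) = real (Suc n) * (d \<bullet> i - x \<bullet> i)" for n
      by (simp_all add: algebra_simps)
    show "(\<lambda>n. flat_exp 1 (real (Suc n) * (x \<bullet> i) + - (real (Suc n) * (c \<bullet> i)))) \<longlonglongrightarrow> 1"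
      "(\<lambda>n. flat_exp 1 (- real (Suc n) * (x \<bullet> i) + real (Suc n) * (d \<bullet> i))) \<longlonglongrightarrow> 1"
      unfolding eq by (intro flat_exp_1_scaled_tendsto i)+
  qed
  then show ?thesis using True by simp
next
  case False
  then show ?thesis by (simp add: box_bump_eq_0)
qed

section \<open>Weak partial derivatives\<close>

text \<open>The bumps are test functions bounded by 1 that converge to the indicator of the box, so
  dominated convergence applies.\<close>

lemma integral_box_eq_0_if_test_integrals_eq_0:
  fixes f :: "'a::euclidean_space \<Rightarrow> 'b::euclidean_space"
  assumes f: "f locally_integrable_on S"
    and 0: "\<And>\<phi>. test_function S \<phi> \<Longrightarrow> (LINT x:S|lebesgue. \<phi> x *\<^sub>R f x) = 0"
    and sub: "cbox c d \<subseteq> S"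
  shows "(LINT x:box c d|lebesgue. f x) = 0"
proof -
  \<comment> \<open>Truncation to the compact box makes \<open>f\<close> integrable and is invisible
    to the bumps, which vanish outside \<open>box c d\<close>.\<close>
  define F where "F = (\<lambda>x. indicator (cbox c d) x *\<^sub>R f x)"
  have F: "integrable lebesgue F"
    using f sub unfolding locally_integrable_on_def set_integrable_def F_def by auto
  have bump_F: "box_bump n c d x *\<^sub>R F x = indicator S x *\<^sub>R (box_bump n c d x *\<^sub>R f x)" for n x
    using box_bump_eq_0[of x c d n] sub box_subset_cbox[of c d]
    by (cases "x \<in> box c d") (auto simp: F_def indicator_def)
  have [measurable]: "box_bump n c d \<in> borel_measurable lebesgue" for n
    using Ck_on_box_bump[of 0 n c d] borel_measurable_continuous_onI
    by (intro measurable_completion) auto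
  have [measurable]: "F \<in> borel_measurable lebesgue" "box c d \<in> sets lebesgue"
    using F by auto
  have "(\<lambda>n. LINT x|lebesgue. box_bump n c d x *\<^sub>R F x) \<longlonglongrightarrow>
      (LINT x|lebesgue. indicator (box c d) x *\<^sub>R F x)"
  proof (rule integral_dominated_convergence[where w = "\<lambda>x. norm (F x)"])
    show "integrable lebesgue (\<lambda>x. norm (F x))" using F by simp
    show "AE x in lebesgue. (\<lambda>n. box_bump n c d x *\<^sub>R F x) \<longlonglongrightarrow> indicator (box c d) x *\<^sub>R F x"
      by (intro always_eventually allI tendsto_intros box_bump_tendsto)
    show "AE x in lebesgue. norm (box_bump n c d x *\<^sub>R F x) \<le> norm (F x)" for n
      by (intro always_eventually allI) (simp add: box_bump_bounds mult_left_le_one_le)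
  qed measurable
  moreover have "(LINT x|lebesgue. box_bump n c d x *\<^sub>R F x) = 0" for n
    using 0[OF test_function_box_bump[OF sub, of n]]
    unfolding bump_F set_lebesgue_integral_def by simp
  moreover have "indicator (box c d) x *\<^sub>R F x = indicator (box c d) x *\<^sub>R f x" for x
    using box_subset_cbox[of c d] by (auto simp: F_def indicator_def)
  ultimately show ?thesis
    unfolding set_lebesgue_integral_def by (simp add: LIMSEQ_const_iff)
qed

lemma sigma_finite_lebesgue: "sigma_finite_measure (lebesgue :: 'a::euclidean_space measure)"
proof
  obtain A :: "'a set set" where "countable A" "A \<subseteq> sets lborel" "\<Union>A = space lborel"
      "\<forall>a\<in>A. emeasure lborel a \<noteq> \<infinity>"
    using lborel.sigma_finite_countable by blast
  then show "\<exists>A::'a set set. countable A \<and> A \<subseteq> sets lebesgue \<and> \<Union>A = space lebesgue \<and>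
      (\<forall>a\<in>A. emeasure lebesgue a \<noteq> \<infinity>)"
    by (intro exI[of _ A]) (auto simp: subset_iff)
qed

text \<open>Boxes form an intersection-stable generator of the Borel sets, and the sets with
  vanishing integral are closed under disjoint unions and, by the assumption on the total integral,
  complements.\<close>

lemma integral_eq_0_if_box_integrals_eq_0:
  fixes F :: "'a::euclidean_space \<Rightarrow> 'b::euclidean_space"
  assumes F: "integrable lebesgue F"
    and 0: "\<And>c d. (LINT x:box c d|lebesgue. F x) = 0" and UNIV: "(LINT x|lebesgue. F x) = 0"
  shows "AE x in lebesgue. F x = 0"
proof (rule sigma_finite_measure.density_zero[OF sigma_finite_lebesgue F])
  have int: "set_integrable lebesgue A F" if "A \<in> sets lebesgue" for A
    using integrable_mult_indicator[OF that F] by (simp add: set_integrable_def)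
  have borel0: "(LINT x:A|lebesgue. F x) = 0" if "A \<in> sets borel" for A
  proof -
    have "Int_stable (range (\<lambda>(a, b). box a b :: 'a set))"
      by (auto simp: Int_stable_def Int_interval image_iff box_Int_box)
    moreover have "range (\<lambda>(a, b). box a b :: 'a set) \<subseteq> Pow UNIV" by simp
    moreover have "A \<in> sigma_sets UNIV (range (\<lambda>(a, b). box a b :: 'a set))"
      using that unfolding borel_eq_box by simp
    ultimately show ?thesis
    proof (induction rule: sigma_sets_induct_disjoint)
      case (basic A)
      then show ?case using 0 by auto
    next
      case empty
      then show ?case by (simp add: set_lebesgue_integral_def)
    next
      case (compl A)
      then have "A \<in> sets borel" unfolding borel_eq_box by simp
      then have A: "A \<in> sets lebesgue" "- A \<in> sets lebesgue" by auto
      have "(LINT x|lebesgue. F x) = (LINT x:A \<union> - A|lebesgue. F x)"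
        by (simp add: set_lebesgue_integral_def)
      also have "\<dots> = (LINT x:A|lebesgue. F x) + (LINT x:- A|lebesgue. F x)"
        using A by (intro set_integral_Un int) auto
      finally show ?case using compl UNIV by (simp add: Compl_eq_Diff_UNIV)
    next
      case (union A)
      then have "A i \<in> sets borel" for i unfolding borel_eq_box by auto
      then have A: "A i \<in> sets lebesgue" for i by auto
      have "(LINT x:(\<Union>i. A i)|lebesgue. F x) = (\<Sum>i. LINT x:A i|lebesgue. F x)"
        using A union(1) int[of "\<Union>i. A i"] by (intro lebesgue_integral_countable_add) (auto simp: disjoint_family_on_def)
      then show ?case using union by simp
    qed
  qed
  fix A :: "'a set" assume A: "A \<in> sets lebesgue"
  \<comment> \<open>Lebesgue sets are reduced to Borel sets by discarding a null set.\<close>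
  obtain B N where B: "fsigma B" "N \<in> null_sets lebesgue" "B \<union> N = A"
    using lebesgue_set_almost_fsigma[OF A] by metis
  have "B \<in> sets borel" using B(1) by (cases rule: fsigma.cases) (auto intro: borel_closed)
  then have "(LINT x:B|lebesgue. F x) = 0" and [simp]: "B \<in> sets lebesgue" by (auto intro: borel0)
  moreover have "(LINT x:A|lebesgue. F x) = (LINT x:B|lebesgue. F x)"
  proof (rule set_integral_null_delta[OF F A])
    show "(A - B) \<union> (B - A) \<in> null_sets lebesgue"
      by (rule null_sets_subset[OF B(2)]) (use A \<open>B \<in> sets lebesgue\<close> B(3) in \<open>blast+\<close>)
  qed simp
  ultimately show "(LINT x:A|lebesgue. F x) = 0" by simp
qed

text \<open>First \<open>f\<close> is shown to vanish almost everywhere on each box whose closed box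
  lies in \<open>S\<close>; countably many such boxes cover \<open>S\<close>, so the null sets add
  up to a null set.\<close>

lemma AE_eq_0_if_test_integrals_eq_0:
  fixes f :: "'a::euclidean_space \<Rightarrow> 'b::euclidean_space"
  assumes S: "open S" and f: "f locally_integrable_on S"
    and 0: "\<And>\<phi>. test_function S \<phi> \<Longrightarrow> (LINT x:S|lebesgue. \<phi> x *\<^sub>R f x) = 0"
  shows "AE x in lebesgue. x \<in> S \<longrightarrow> f x = 0"
proof -
  have box: "AE x in lebesgue. x \<in> box c d \<longrightarrow> f x = 0" if sub: "cbox c d \<subseteq> S" for c d
  proof -
    define F where "F = (\<lambda>x. indicator (box c d) x *\<^sub>R f x)"
    have "set_integrable lebesgue (cbox c d) f"
      using f sub by (auto simp: locally_integrable_on_def)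
    then have "set_integrable lebesgue (box c d) f"
      by (rule set_integrable_subset) (auto simp: box_subset_cbox)
    then have F: "integrable lebesgue F" by (simp add: F_def set_integrable_def)
    have F0: "(LINT x:box a b|lebesgue. F x) = 0" for a b
    proof -
      obtain a' b' where eq: "box a b \<inter> box c d = box a' b'"
        by (rule that[OF box_Int_box])
      \<comment> \<open>The empty case is separate because \<open>cbox a' b'\<close> may then be
        nonempty and leave \<open>S\<close>; otherwise it is the closure of
        \<open>box a' b'\<close>.\<close>
      show ?thesis
      proof (cases "box a' b' = {}")
        case True
        then have "box a b \<inter> box c d = {}" by (simp only: eq)
        then have "indicator (box a b) x *\<^sub>R F x = 0" for x
          unfolding F_def by (simp only: scaleR_scaleR indicator_inter_arith[symmetric]
            indicator_simps empty_iff not_False_eq_True scaleR_zero_left)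
        then have "(\<lambda>x. indicator (box a b) x *\<^sub>R F x) = (\<lambda>x. 0)" by (rule ext)
        then show ?thesis by (simp add: set_lebesgue_integral_def)
      next
        case False
        then have "closure (box a' b') = cbox a' b'" by (rule closure_box)
        moreover have "box a' b' \<subseteq> cbox c d"
          unfolding eq[symmetric] using box_subset_cbox[of c d] by blast
        then have "closure (box a' b') \<subseteq> cbox c d" by (rule closure_minimal[OF _ closed_cbox])
        ultimately have "cbox a' b' \<subseteq> S" using sub by (simp only: order_trans)
        from integral_box_eq_0_if_test_integrals_eq_0[OF f 0 this]
        have "(LINT x:box a' b'|lebesgue. f x) = 0" .
        moreover have "indicator (box a b) x *\<^sub>R F x = indicator (box a' b') x *\<^sub>R f x" for x
          unfolding F_def eq[symmetric] indicator_inter_arith scaleR_scaleR ..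
        ultimately show ?thesis by (simp only: set_lebesgue_integral_def)
      qed
    qed
    have "(LINT x|lebesgue. F x) = (LINT x:box c d|lebesgue. F x)"
      unfolding set_lebesgue_integral_def
      by (rule Bochner_Integration.integral_cong)
        (simp_all only: F_def scaleR_scaleR indicator_inter_arith[symmetric] Int_absorb)
    also have "\<dots> = 0" by (rule F0)
    finally have "AE x in lebesgue. F x = 0" by (rule integral_eq_0_if_box_integrals_eq_0[OF F F0])
    then show ?thesis 
    proof (rule eventually_mono)
      fix x assume "F x = 0"
      then show "x \<in> box c d \<longrightarrow> f x = 0" unfolding F_def by (cases "x \<in> box c d") simp_all
    qed
  qed
  define D0 where "D0 = {box c d |c d. cbox c d \<subseteq> S}"
  have open_D0: "open X" if "X \<in> D0" for X using that by (auto simp: D0_def)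
  obtain D where D: "D \<subseteq> D0" "countable D" "\<Union>D = \<Union>D0"
    by (rule Lindelof[of D0, OF open_D0])
  have cover: "\<exists>X\<in>D. x \<in> X" if x: "x \<in> S" for x
  proof -
    obtain c d where "cbox c d \<subseteq> S" "x \<in> box c d" using open_contains_cbox[OF S x] by metis
    then have "box c d \<in> D0" "x \<in> box c d" unfolding D0_def by auto
    then have "x \<in> \<Union>D" unfolding D(3) by (rule UnionI)
    then show ?thesis by (rule UnionE) (rule bexI)
  qed
  have "AE x in lebesgue. \<forall>X\<in>D. x \<in> X \<longrightarrow> f x = 0"
    unfolding AE_ball_countable[OF D(2)]
  proof
    fix X assume "X \<in> D"
    then obtain c d where "X = box c d" "cbox c d \<subseteq> S" using D(1) unfolding D0_def by blast
    then show "AE x in lebesgue. x \<in> X \<longrightarrow> f x = 0" using box by simp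
  qed
  then show ?thesis
  proof (rule eventually_mono, intro impI)
    fix x assume "\<forall>X\<in>D. x \<in> X \<longrightarrow> f x = 0" "x \<in> S"
    with cover[of x] show "f x = 0" by metis
  qed
qed

text \<open>On \<open>K\<close> the factor \<psi> is bounded and \<open>f\<close> is integrable; off
  \<open>K\<close> the product vanishes.\<close>

lemma set_integrable_scaleR_compact_support:
  fixes f :: "'a::euclidean_space \<Rightarrow> 'b::euclidean_space"
  assumes f: "f locally_integrable_on S" and K: "compact K" "K \<subseteq> S"
    and \<psi>: "continuous_on UNIV \<psi>" "\<And>x. x \<notin> K \<Longrightarrow> \<psi> x = 0"
  shows "set_integrable lebesgue S (\<lambda>x. \<psi> x *\<^sub>R f x)"
proof -
  have "bounded (\<psi> ` K)"
    using K \<psi> by (intro compact_imp_bounded compact_continuous_image) (auto intro: continuous_on_subset)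
  then obtain B where "\<forall>y\<in>\<psi> ` K. norm y \<le> B" by (auto simp: bounded_iff)
  \<comment> \<open>The absolute value of \<open>B\<close> is taken because \<open>B\<close> may be
    negative when \<open>K\<close> is empty.\<close>
  then have B: "\<bar>\<psi> x\<bar> \<le> \<bar>B\<bar>" for x using \<psi>(2)[of x] by (cases "x \<in> K") force+
  have bnd: "norm (\<psi> x *\<^sub>R v) \<le> norm (\<bar>B\<bar> * norm v)" for x and v :: 'b
    by (simp add: B mult_right_mono abs_mult)
  have int: "integrable lebesgue (\<lambda>x. indicator K x *\<^sub>R f x)"
    using f K by (auto simp: locally_integrable_on_def set_integrable_def)
  have [measurable]: "\<psi> \<in> borel_measurable lebesgue"
    using \<psi>(1) by (intro measurable_completion) (auto intro: borel_measurable_continuous_onI)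
  have "integrable lebesgue (\<lambda>x. \<psi> x *\<^sub>R (indicator K x *\<^sub>R f x))"
  proof (rule Bochner_Integration.integrable_bound)
    show "integrable lebesgue (\<lambda>x. \<bar>B\<bar> * norm (indicator K x *\<^sub>R f x))"
      by (intro integrable_mult_right integrable_norm int)
    show "AE x in lebesgue. norm (\<psi> x *\<^sub>R (indicator K x *\<^sub>R f x))
        \<le> norm (\<bar>B\<bar> * norm (indicator K x *\<^sub>R f x))"
      by (intro always_eventually allI bnd)
  qed (use borel_measurable_integrable[OF int] in measurable)
  moreover have "\<psi> x *\<^sub>R (indicator K x *\<^sub>R f x) = indicator S x *\<^sub>R (\<psi> x *\<^sub>R f x)" for x
    using K \<psi>(2)[of x] by (auto simp: indicator_def)
  ultimately show ?thesis by (simp only: set_integrable_def)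
qed

text \<open>The complement of the closed support is open, so \<phi> vanishes near each of its points
  and the derivative vanishes there too.\<close>

lemma test_function_support:
  fixes S :: "'a::euclidean_space set"
  assumes "test_function S \<phi>"
  obtains K where "compact K" "K \<subseteq> S" "\<And>x. x \<notin> K \<Longrightarrow> \<phi> x = 0"
    "\<And>x i. x \<notin> K \<Longrightarrow> frechet_derivative \<phi> (at x) i = 0"
proof
  define K where "K = closure {x. \<phi> x \<noteq> 0}"
  show "compact K" "K \<subseteq> S" using assms by (auto simp: test_function_def K_def)
  have "{x. \<phi> x \<noteq> 0} \<subseteq> K" unfolding K_def by (rule closure_subset)
  then show \<phi>: "\<phi> x = 0" if "x \<notin> K" for x using that by auto
  have "open (- K)" by (simp only: K_def open_Compl closed_closure)
  show "frechet_derivative \<phi> (at x) i = 0" if "x \<notin> K" for x i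
  proof -
    have "(\<phi> has_derivative (\<lambda>h. 0)) (at x)"
      by (rule has_derivative_transform_within_open[OF has_derivative_const \<open>open (- K)\<close>])
        (use that \<phi> in auto)
    from frechet_derivative_at[OF this, symmetric] show ?thesis by simp
  qed
qed

lemma test_function_differentiable:
  assumes "test_function S \<phi>"
  shows "(\<phi> has_derivative frechet_derivative \<phi> (at x)) (at x)"
    and "continuous_on UNIV \<phi>"
    and "i \<in> Basis \<Longrightarrow> continuous_on UNIV (\<lambda>x. frechet_derivative \<phi> (at x) i)"
proof -
  have "Ck_on 0 UNIV \<phi>" "Ck_on 1 UNIV \<phi>" using assms by (auto simp: test_function_def simp del: Ck_on.simps)
  then show "(\<phi> has_derivative frechet_derivative \<phi> (at x)) (at x)" "continuous_on UNIV \<phi>"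
    "i \<in> Basis \<Longrightarrow> continuous_on UNIV (\<lambda>x. frechet_derivative \<phi> (at x) i)"
    by (auto simp: frechet_derivative_works)
qed

text \<open>The two defining identities share their left-hand side, so \<open>g - h\<close>
  integrates to 0 against every test function.\<close>

lemma weak_partial_unique:
  fixes g h :: "'a::euclidean_space \<Rightarrow> 'b::euclidean_space"
  assumes S: "open S" and g: "has_weak_partial S i v g" and h: "has_weak_partial S i v h"
  shows "AE x in lebesgue. x \<in> S \<longrightarrow> g x = h x"
proof -
  have int: "set_integrable lebesgue S (\<lambda>x. \<phi> x *\<^sub>R f x)"
    if \<phi>: "test_function S \<phi>" and f: "f locally_integrable_on S" for \<phi> and f :: "'a \<Rightarrow> 'b"
    by (rule test_function_support[OF \<phi>])
      (rule set_integrable_scaleR_compact_support[OF f _ _ test_function_differentiable(2)[OF \<phi>]])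
  have loc: "g locally_integrable_on S" "h locally_integrable_on S"
    using g h by (simp_all only: has_weak_partial_def)
  have "AE x in lebesgue. x \<in> S \<longrightarrow> g x - h x = 0"
  proof (rule AE_eq_0_if_test_integrals_eq_0[OF S])
    show "(\<lambda>x. g x - h x) locally_integrable_on S"
      using loc unfolding locally_integrable_on_def by (blast intro: set_integral_diff(1))
    fix \<phi> assume \<phi>: "test_function S \<phi>"
    have "- (LINT x:S|lebesgue. \<phi> x *\<^sub>R g x) = - (LINT x:S|lebesgue. \<phi> x *\<^sub>R h x)"
      using g h \<phi> unfolding has_weak_partial_def by metis
    then have "(LINT x:S|lebesgue. \<phi> x *\<^sub>R g x) - (LINT x:S|lebesgue. \<phi> x *\<^sub>R h x) = 0" by simp
    then show "(LINT x:S|lebesgue. \<phi> x *\<^sub>R (g x - h x)) = 0"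
      by (simp only: scaleR_diff_right set_integral_diff(2)[OF int[OF \<phi> loc(1)] int[OF \<phi> loc(2)]])
  qed
  then show ?thesis by simp
qed

section \<open>Continuous classical partial derivatives are weak partial derivatives\<close>

lemma set_integrable_continuous_compact:
  fixes f :: "'a::euclidean_space \<Rightarrow> 'b::euclidean_space"
  assumes "compact K" "continuous_on K f"
  shows "set_integrable lebesgue K f"
proof -
  have "integrable lborel (\<lambda>x. indicator K x *\<^sub>R f x)"
    using assms by (rule borel_integrable_compact)
  then show ?thesis
    unfolding set_integrable_def using integrable_completion borel_measurable_integrable by blast
qed

lemma locally_integrable_on_continuous:
  fixes f :: "'a::euclidean_space \<Rightarrow> 'b::euclidean_space"
  assumes "continuous_on S f"
  shows "f locally_integrable_on S"
  unfolding locally_integrable_on_def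
  using assms set_integrable_continuous_compact continuous_on_subset by metis

lemma integral_difference_quotient_eq_0:
  fixes F :: "'a::euclidean_space \<Rightarrow> 'b::euclidean_space"
  assumes F: "integrable lborel F"
  shows "(LINT x|lborel. (1 / h) *\<^sub>R (F (x + c) - F x)) = 0"
proof -
  have F_meas [measurable]: "F \<in> borel_measurable borel" using borel_measurable_integrable[OF F] by simp
  have "integrable (distr lborel borel ((+) c)) F" unfolding lborel_distr_plus by (rule F)
  then have int: "integrable lborel (\<lambda>x. F (c + x))" by (subst (asm) integrable_distr_eq) auto
  have "(LINT x|distr lborel borel ((+) c). F x) = (LINT x|lborel. F (c + x))"
    by (rule integral_distr) auto
  then have "(LINT x|lborel. F (c + x)) = (LINT x|lborel. F x)" unfolding lborel_distr_plus by simp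
  then show ?thesis using int F by (simp add: add.commute)
qed

text \<open>The integrals of the difference quotients of \<open>F\<close> vanish by translation invariance.\<close>

lemma integral_directional_derivative_eq_0:
  fixes F G :: "'a::euclidean_space \<Rightarrow> 'b::euclidean_space"
  assumes i: "i \<in> Basis" and K: "compact K" and F: "continuous_on UNIV F" and G: "continuous_on UNIV G"
    and supp: "\<And>x. x \<notin> K \<Longrightarrow> F x = 0" "\<And>x. x \<notin> K \<Longrightarrow> G x = 0"
    and deriv: "\<And>x. ((\<lambda>t. F (x + t *\<^sub>R i)) has_vector_derivative G x) (at 0)"
  shows "(LINT x|lborel. G x) = 0"
proof -
  define h where "h = (\<lambda>n. inverse (real (Suc n)))"
  define D where "D = (\<lambda>n x. (1 / h n) *\<^sub>R (F (x + h n *\<^sub>R i) - F x))"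
  have h: "0 < h n" "h n \<le> 1" for n by (auto simp: h_def field_simps)
  have [measurable]: "F \<in> borel_measurable borel" "G \<in> borel_measurable borel"
    using F G by (auto intro: borel_measurable_continuous_onI)
  have "bounded (G ` K)"
    using G K by (intro compact_imp_bounded compact_continuous_image) (auto intro: continuous_on_subset)
  then obtain B0 where B0: "\<And>y. y \<in> G ` K \<Longrightarrow> norm y \<le> B0" unfolding bounded_iff by blast
  \<comment> \<open>\<open>B0\<close> may be negative if \<open>K\<close> is empty; its absolute
    value also bounds \<open>G\<close> off \<open>K\<close>.\<close>
  define B where "B = \<bar>B0\<bar>"
  have B: "norm (G x) \<le> B" for x
    using supp(2)[of x] B0[of "G x"] by (cases "x \<in> K") (auto simp: B_def)
  obtain R where R: "\<And>x. x \<in> K \<Longrightarrow> norm x \<le> R"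
    using compact_imp_bounded[OF K] unfolding bounded_iff by blast
  \<comment> \<open>The hypothesis gives the derivative at parameter 0 only; a shift of the base
    point gives it at every \<open>t\<close>.\<close>
  have deriv_t: "((\<lambda>t. F (x + t *\<^sub>R i)) has_vector_derivative G (x + t *\<^sub>R i)) (at t within T)" for x t T
  proof -
    have "((\<lambda>s. s - t) has_vector_derivative 1) (at t)"
      by (auto intro!: derivative_eq_intros)
    moreover have "((\<lambda>s. F (x + t *\<^sub>R i + s *\<^sub>R i)) has_vector_derivative G (x + t *\<^sub>R i)) (at (t - t))"
      using deriv[of "x + t *\<^sub>R i"] by simp
    ultimately have "(((\<lambda>s. F (x + t *\<^sub>R i + s *\<^sub>R i)) \<circ> (\<lambda>s. s - t)) has_vector_derivative
        1 *\<^sub>R G (x + t *\<^sub>R i)) (at t)"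
      by (rule vector_diff_chain_at)
    then have "((\<lambda>s. F (x + s *\<^sub>R i)) has_vector_derivative G (x + t *\<^sub>R i)) (at t)"
      by (simp add: o_def algebra_simps)
    then show ?thesis by (rule has_vector_derivative_at_within)
  qed
  \<comment> \<open>Mean value inequality along the line through \<open>x\<close> in direction
    \<open>i\<close>.\<close>
  have D_le: "norm (D n x) \<le> B" for n x
  proof -
    have "norm (F (x + h n *\<^sub>R i) - F (x + 0 *\<^sub>R i)) \<le> B * norm (h n - 0)"
    proof (rule differentiable_bound[of UNIV "\<lambda>t. F (x + t *\<^sub>R i)" "\<lambda>t s. s *\<^sub>R G (x + t *\<^sub>R i)"])
      show "((\<lambda>t. F (x + t *\<^sub>R i)) has_derivative (\<lambda>s. s *\<^sub>R G (x + t *\<^sub>R i))) (at t within UNIV)" for t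
        using deriv_t[of x t UNIV] by (simp add: has_vector_derivative_def)
      show "onorm (\<lambda>s. s *\<^sub>R G (x + t *\<^sub>R i)) \<le> B" for t
      proof (rule onorm_le)
        show "norm (s *\<^sub>R G (x + t *\<^sub>R i)) \<le> B * norm s" for s
          using mult_left_mono[OF B[of "x + t *\<^sub>R i"], of "\<bar>s\<bar>"] by (simp add: mult.commute)
      qed
    qed auto
    then show ?thesis using h[of n] by (simp add: D_def divide_le_eq)
  qed
  \<comment> \<open>The steps \<open>h n\<close> are at most 1, so all difference quotients live in
    one ball; this gives an integrable majorant common to all \<open>n\<close>.\<close>
  have D_supp: "D n x = 0" if "x \<notin> cball 0 (R + 1)" for n x
  proof -
    have nx: "R + 1 < norm x" using that by simp
    have "norm x \<le> norm (x + h n *\<^sub>R i) + norm (h n *\<^sub>R i)"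
      using norm_triangle_ineq4[of "x + h n *\<^sub>R i" "h n *\<^sub>R i"] by simp
    then have "R < norm (x + h n *\<^sub>R i)" using nx h[of n] i by simp
    then have "x + h n *\<^sub>R i \<notin> K" using R[of "x + h n *\<^sub>R i"] by auto
    moreover have "x \<notin> K" using R[of x] nx by auto
    ultimately show ?thesis by (simp add: D_def supp(1))
  qed
  have "integrable lborel (\<lambda>x. indicator K x *\<^sub>R F x)"
    using K F by (intro borel_integrable_compact) (auto intro: continuous_on_subset)
  moreover have "(\<lambda>x. indicator K x *\<^sub>R F x) = F"
    using supp(1) by (auto simp: fun_eq_iff indicator_def)
  ultimately have F_int: "integrable lborel F" by simp
  have "(\<lambda>n. LINT x|lborel. D n x) \<longlonglongrightarrow> (LINT x|lborel. G x)"
  proof (rule integral_dominated_convergence[where w = "\<lambda>x. indicator (cball 0 (R + 1)) x *\<^sub>R B"])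
    show "D n \<in> borel_measurable lborel" for n unfolding D_def by measurable
    show "integrable lborel (\<lambda>x::'a. indicator (cball 0 (R + 1)) x *\<^sub>R B)"
      by (rule borel_integrable_compact) auto
    show "AE x in lborel. norm (D n x) \<le> indicator (cball 0 (R + 1)) x *\<^sub>R B" for n
      using D_le D_supp by (intro always_eventually allI) (auto simp: indicator_def)
    have "(\<lambda>n. D n x) \<longlonglongrightarrow> G x" for x
    proof -
      have "((\<lambda>t. (F (x + t *\<^sub>R i) - F x - t *\<^sub>R G x) /\<^sub>R \<bar>t\<bar>) \<longlongrightarrow> 0) (at 0)"
        using deriv[of x] by (simp add: has_vector_derivative_def has_derivative_at_within)
      moreover have "filterlim h (at 0) sequentially"
        unfolding filterlim_at h_def using LIMSEQ_inverse_real_of_nat by auto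
      ultimately have "(\<lambda>n. (F (x + h n *\<^sub>R i) - F x - h n *\<^sub>R G x) /\<^sub>R \<bar>h n\<bar>) \<longlonglongrightarrow> 0"
        by (rule filterlim_compose)
      moreover have "(F (x + h n *\<^sub>R i) - F x - h n *\<^sub>R G x) /\<^sub>R \<bar>h n\<bar> = D n x - G x" for n
        using h[of n] by (simp add: D_def scaleR_diff_right divide_inverse)
      ultimately have "(\<lambda>n. D n x - G x) \<longlonglongrightarrow> 0" by simp
      then show ?thesis by (simp add: LIM_zero_iff)
    qed
    then show "AE x in lborel. (\<lambda>n. D n x) \<longlonglongrightarrow> G x" by simp
  qed measurable
  moreover have "(LINT x|lborel. D n x) = 0" for n
    unfolding D_def by (rule integral_difference_quotient_eq_0[OF F_int])
  ultimately show ?thesis by (simp add: LIMSEQ_const_iff)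
qed

text \<open>Integration by parts: extended by 0, the product of \<phi> and \<open>v\<close> is
  compactly supported, and its derivative \<open>G\<close> in direction \<open>i\<close>, given by
  the product rule, has integral 0.\<close>

lemma has_weak_partial_if_continuous_partial:
  fixes v g :: "'a::euclidean_space \<Rightarrow> 'b::euclidean_space"
  assumes S: "open S" and i: "i \<in> Basis" and v: "continuous_on S v" and g: "continuous_on S g"
    and deriv: "\<And>x. x \<in> S \<Longrightarrow> ((\<lambda>t. v (x + t *\<^sub>R i)) has_vector_derivative g x) (at 0)"
  shows "has_weak_partial S i v g"
proof -
  note loc = locally_integrable_on_continuous
  show ?thesis
    unfolding has_weak_partial_def
  proof (intro conjI allI impI loc v g)
    fix \<phi> :: "'a \<Rightarrow> real" assume \<phi>: "test_function S \<phi>"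
    obtain K where K: "compact K" "K \<subseteq> S" "\<And>x. x \<notin> K \<Longrightarrow> \<phi> x = 0"
      "\<And>x i. x \<notin> K \<Longrightarrow> frechet_derivative \<phi> (at x) i = 0"
      using test_function_support[OF \<phi>] by metis
    note D = test_function_differentiable[OF \<phi>]
    define \<psi> where "\<psi> = (\<lambda>x. frechet_derivative \<phi> (at x) i)"
    have \<psi>: "continuous_on UNIV \<psi>" "\<And>x. x \<notin> K \<Longrightarrow> \<psi> x = 0"
      unfolding \<psi>_def using D(3)[OF i] K(4) by auto
    \<comment> \<open>The extension by 0 is continuous because the open sets \<open>S\<close> and
      \<open>- K\<close> cover the space, and on \<open>- K\<close> it is identically 0.\<close>
    have ext: "continuous_on UNIV (\<lambda>x. if x \<in> S then f x else 0)"
      if f: "continuous_on S f" "\<And>x. x \<notin> K \<Longrightarrow> f x = 0" for f :: "'a \<Rightarrow> 'b"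
    proof -
      have "continuous_on S (\<lambda>x. if x \<in> S then f x else 0)"
        using f(1) by (rule continuous_on_eq) simp
      moreover have "continuous_on (- K) (\<lambda>x. if x \<in> S then f x else 0)"
        by (rule continuous_on_eq[OF continuous_on_const[of _ 0]]) (simp add: f(2))
      moreover have "open (- K)" using K(1) by (simp add: open_Compl compact_imp_closed)
      moreover have "S \<union> - K = UNIV" using K(2) by blast
      ultimately show ?thesis using continuous_on_open_Un[OF S] by metis
    qed
    define F where "F = (\<lambda>x. if x \<in> S then \<phi> x *\<^sub>R v x else 0)"
    define G where "G = (\<lambda>x. if x \<in> S then \<phi> x *\<^sub>R g x + \<psi> x *\<^sub>R v x else 0)"
    have \<phi>S: "continuous_on S \<phi>" "continuous_on S \<psi>"
      using D(2) \<psi>(1) by (auto intro: continuous_on_subset)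
    have "(LINT x|lborel. G x) = 0"
    proof (rule integral_directional_derivative_eq_0[OF i K(1)])
      show "continuous_on UNIV F" unfolding F_def
        by (rule ext) (use K in \<open>auto intro!: continuous_intros \<phi>S v\<close>)
      show "continuous_on UNIV G" unfolding G_def
        by (rule ext) (use K \<psi> in \<open>auto intro!: continuous_intros \<phi>S v g\<close>)
      show "F x = 0" "G x = 0" if "x \<notin> K" for x
        using that K(3) \<psi>(2) by (auto simp: F_def G_def)
      show "((\<lambda>t. F (x + t *\<^sub>R i)) has_vector_derivative G x) (at 0)" for x
      proof (cases "x \<in> S")
        case True
        have line: "((\<lambda>t. x + t *\<^sub>R i) has_derivative (\<lambda>t. t *\<^sub>R i)) (at 0)"
          by (auto intro!: derivative_eq_intros)
        have "((\<lambda>t. \<phi> (x + t *\<^sub>R i)) has_derivative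
            (\<lambda>t. frechet_derivative \<phi> (at x) (t *\<^sub>R i))) (at 0)"
          using has_derivative_compose[OF line, of \<phi> "frechet_derivative \<phi> (at x)"] D(1)[of x] by simp
        moreover have "frechet_derivative \<phi> (at x) (t *\<^sub>R i) = t *\<^sub>R \<psi> x" for t
          unfolding \<psi>_def using linear_scale[OF has_derivative_linear[OF D(1)]] by simp
        ultimately have "((\<lambda>t. \<phi> (x + t *\<^sub>R i)) has_vector_derivative \<psi> x) (at 0)"
          by (simp add: has_vector_derivative_def)
        then have "((\<lambda>t. \<phi> (x + t *\<^sub>R i)) has_real_derivative \<psi> x) (at 0)"
          by (simp add: has_real_derivative_iff_has_vector_derivative)
        from has_vector_derivative_scaleR[OF this deriv[OF True]]
        have "((\<lambda>t. \<phi> (x + t *\<^sub>R i) *\<^sub>R v (x + t *\<^sub>R i)) has_vector_derivative G x) (at 0)"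
          using True by (simp add: G_def)
        moreover have "open ((\<lambda>t. x + t *\<^sub>R i) -` S)"
          by (intro open_vimage S continuous_intros)
        ultimately show ?thesis
          by (rule has_vector_derivative_transform_within_open) (use True in \<open>auto simp: F_def\<close>)
      next
        case False
        then have "x \<in> - K" using K(2) by blast
        have "open (- K)" using K(1) by (simp add: open_Compl compact_imp_closed)
        then have "open ((\<lambda>t. x + t *\<^sub>R i) -` (- K))"
          by (rule open_vimage) (intro continuous_intros)
        with has_vector_derivative_const[of 0 "at 0"]
        have "((\<lambda>t. F (x + t *\<^sub>R i)) has_vector_derivative 0) (at 0)"
          by (rule has_vector_derivative_transform_within_open)
            (use \<open>x \<in> - K\<close> K(3) in \<open>auto simp: F_def\<close>)
        then show ?thesis using False by (simp add: G_def)
      qed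
    qed
    moreover have "continuous_on UNIV G" unfolding G_def
      by (rule ext) (use K \<psi> in \<open>auto intro!: continuous_intros \<phi>S v g\<close>)
    then have "G \<in> borel_measurable lborel" by (auto intro: borel_measurable_continuous_onI)
    ultimately have "(LINT x|lebesgue. G x) = 0" by (simp add: integral_completion)
    moreover have "G = (\<lambda>x. indicator S x *\<^sub>R (\<phi> x *\<^sub>R g x + \<psi> x *\<^sub>R v x))"
      by (auto simp: G_def indicator_def)
    ultimately have "(LINT x:S|lebesgue. \<phi> x *\<^sub>R g x + \<psi> x *\<^sub>R v x) = 0"
      by (simp only: set_lebesgue_integral_def)
    moreover have "set_integrable lebesgue S (\<lambda>x. \<phi> x *\<^sub>R g x)"
      by (rule set_integrable_scaleR_compact_support[OF loc[OF g] K(1,2) D(2) K(3)])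
    moreover have "set_integrable lebesgue S (\<lambda>x. \<psi> x *\<^sub>R v x)"
      by (rule set_integrable_scaleR_compact_support[OF loc[OF v] K(1,2) \<psi>])
    ultimately have "(LINT x:S|lebesgue. \<phi> x *\<^sub>R g x) + (LINT x:S|lebesgue. \<psi> x *\<^sub>R v x) = 0"
      by (simp only: set_integral_add(2))
    then show "(LINT x:S|lebesgue. frechet_derivative \<phi> (at x) i *\<^sub>R v x)
        = - (LINT x:S|lebesgue. \<phi> x *\<^sub>R g x)"
      unfolding \<psi>_def by (simp only: eq_neg_iff_add_eq_0 add.commute)
  qed
qed

section \<open>Dominated limits of weak partial derivatives\<close>

lemma locally_integrable_on_limit:
  fixes f :: "nat \<Rightarrow> 'a::euclidean_space \<Rightarrow> 'b::euclidean_space" and w :: "'a \<Rightarrow> real"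
  assumes f: "\<And>n. f n locally_integrable_on S" and w: "w locally_integrable_on S"
    and lim: "\<And>x. x \<in> S \<Longrightarrow> (\<lambda>n. f n x) \<longlonglongrightarrow> g x"
    and le: "\<And>n x. x \<in> S \<Longrightarrow> norm (f n x) \<le> w x"
  shows "g locally_integrable_on S"
  unfolding locally_integrable_on_def set_integrable_def
proof (intro allI impI)
  fix K assume K: "compact K \<and> K \<subseteq> S"
  have f_int: "integrable lebesgue (\<lambda>x. indicator K x *\<^sub>R f n x)" for n
    using f[of n] K by (auto simp: locally_integrable_on_def set_integrable_def)
  have w_int: "integrable lebesgue (\<lambda>x. indicator K x *\<^sub>R w x)"
    using w K by (auto simp: locally_integrable_on_def set_integrable_def)
  have conv: "(\<lambda>n. indicator K x *\<^sub>R f n x) \<longlonglongrightarrow> indicator K x *\<^sub>R g x" for x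
    using K lim[of x] by (cases "x \<in> K") (auto simp: subset_iff)
  show "integrable lebesgue (\<lambda>x. indicator K x *\<^sub>R g x)"
  proof (rule integrable_dominated_convergence[OF _ _ w_int])
    show meas: "(\<lambda>x. indicator K x *\<^sub>R f n x) \<in> borel_measurable lebesgue" for n
      by (rule borel_measurable_integrable[OF f_int])
    show "(\<lambda>x. indicator K x *\<^sub>R g x) \<in> borel_measurable lebesgue"
      by (rule borel_measurable_LIMSEQ_metric[OF meas conv])
    show "AE x in lebesgue. (\<lambda>n. indicator K x *\<^sub>R f n x) \<longlonglongrightarrow> indicator K x *\<^sub>R g x"
      using conv by simp
    show "AE x in lebesgue. norm (indicator K x *\<^sub>R f n x) \<le> indicator K x *\<^sub>R w x" for n
      using le K by (intro always_eventually allI) (auto simp: indicator_def subset_iff)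
  qed
qed

lemma integral_against_compact_support_tendsto:
  fixes f :: "nat \<Rightarrow> 'a::euclidean_space \<Rightarrow> 'b::euclidean_space" and w :: "'a \<Rightarrow> real"
  assumes f: "\<And>n. f n locally_integrable_on S" and w: "w locally_integrable_on S"
    and lim: "\<And>x. x \<in> S \<Longrightarrow> (\<lambda>n. f n x) \<longlonglongrightarrow> g x"
    and le: "\<And>n x. x \<in> S \<Longrightarrow> norm (f n x) \<le> w x"
    and K: "compact K" "K \<subseteq> S"
    and \<psi>: "continuous_on UNIV \<psi>" "\<And>x. x \<notin> K \<Longrightarrow> \<psi> x = 0"
  shows "(\<lambda>n. LINT x:S|lebesgue. \<psi> x *\<^sub>R f n x) \<longlonglongrightarrow> (LINT x:S|lebesgue. \<psi> x *\<^sub>R g x)"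
  unfolding set_lebesgue_integral_def
proof (rule integral_dominated_convergence)
  have g: "g locally_integrable_on S" by (rule locally_integrable_on_limit[OF f w lim le])
  show "(\<lambda>x. indicator S x *\<^sub>R \<psi> x *\<^sub>R g x) \<in> borel_measurable lebesgue"
    using set_integrable_scaleR_compact_support[OF g K \<psi>] unfolding set_integrable_def
    by (rule borel_measurable_integrable)
  show "(\<lambda>x. indicator S x *\<^sub>R \<psi> x *\<^sub>R f n x) \<in> borel_measurable lebesgue" for n
    using set_integrable_scaleR_compact_support[OF f K \<psi>] unfolding set_integrable_def
    by (rule borel_measurable_integrable)
  show "integrable lebesgue (\<lambda>x. indicator S x *\<^sub>R \<bar>\<psi> x\<bar> *\<^sub>R w x)"
    using set_integrable_scaleR_compact_support[OF w K, of "\<lambda>x. \<bar>\<psi> x\<bar>"] \<psi>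
    unfolding set_integrable_def by (auto intro: continuous_intros)
  show "AE x in lebesgue. (\<lambda>n. indicator S x *\<^sub>R \<psi> x *\<^sub>R f n x) \<longlonglongrightarrow> indicator S x *\<^sub>R \<psi> x *\<^sub>R g x"
  proof (intro always_eventually allI)
    fix x show "(\<lambda>n. indicator S x *\<^sub>R \<psi> x *\<^sub>R f n x) \<longlonglongrightarrow> indicator S x *\<^sub>R \<psi> x *\<^sub>R g x"
      using lim[of x] by (cases "x \<in> S") (auto intro: tendsto_intros)
  qed
  show "AE x in lebesgue. norm (indicator S x *\<^sub>R \<psi> x *\<^sub>R f n x) \<le> indicator S x *\<^sub>R \<bar>\<psi> x\<bar> *\<^sub>R w x" for n
    using le[of _ n] by (intro always_eventually allI) (auto simp: indicator_def mult_left_mono)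
qed

text \<open>Both sides of the defining identity converge, as the test function confines the
  integrals to a compact set on which \<open>V\<close> and \<open>G\<close> are integrable.\<close>

lemma has_weak_partial_limit:
  fixes v g :: "nat \<Rightarrow> 'a::euclidean_space \<Rightarrow> 'b::euclidean_space" and V G :: "'a \<Rightarrow> real"
  assumes weak: "\<And>n. has_weak_partial S i (v n) (g n)" and i: "i \<in> Basis"
    and V: "V locally_integrable_on S" and G: "G locally_integrable_on S"
    and v_lim: "\<And>x. x \<in> S \<Longrightarrow> (\<lambda>n. v n x) \<longlonglongrightarrow> v' x" and v_le: "\<And>n x. x \<in> S \<Longrightarrow> norm (v n x) \<le> V x"
    and g_lim: "\<And>x. x \<in> S \<Longrightarrow> (\<lambda>n. g n x) \<longlonglongrightarrow> g' x" and g_le: "\<And>n x. x \<in> S \<Longrightarrow> norm (g n x) \<le> G x"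
  shows "has_weak_partial S i v' g'"
proof -
  note weak' = weak[unfolded has_weak_partial_def]
  note v = weak'[THEN conjunct1] and g = weak'[THEN conjunct2, THEN conjunct1]
  show ?thesis
    unfolding has_weak_partial_def
  proof (intro conjI allI impI)
    show "v' locally_integrable_on S" by (rule locally_integrable_on_limit[where f = v and w = V, OF v V v_lim v_le])
    show "g' locally_integrable_on S" by (rule locally_integrable_on_limit[where f = g and w = G, OF g G g_lim g_le])
    fix \<phi> :: "'a \<Rightarrow> real" assume \<phi>: "test_function S \<phi>"
    obtain K where K: "compact K" "K \<subseteq> S" "\<And>x. x \<notin> K \<Longrightarrow> \<phi> x = 0"
      "\<And>x i. x \<notin> K \<Longrightarrow> frechet_derivative \<phi> (at x) i = 0"
      using test_function_support[OF \<phi>] by metis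
    note D = test_function_differentiable[OF \<phi>]
    have eq: "(LINT x:S|lebesgue. frechet_derivative \<phi> (at x) i *\<^sub>R v n x)
        = - (LINT x:S|lebesgue. \<phi> x *\<^sub>R g n x)" for n
      by (rule weak'[THEN conjunct2, THEN conjunct2, rule_format, OF \<phi>])
    have "(\<lambda>n. LINT x:S|lebesgue. frechet_derivative \<phi> (at x) i *\<^sub>R v n x)
        \<longlonglongrightarrow> (LINT x:S|lebesgue. frechet_derivative \<phi> (at x) i *\<^sub>R v' x)"
      by (rule integral_against_compact_support_tendsto[OF v V v_lim v_le K(1,2) D(3)[OF i] K(4)])
    then have "(\<lambda>n. - (LINT x:S|lebesgue. \<phi> x *\<^sub>R g n x))
        \<longlonglongrightarrow> (LINT x:S|lebesgue. frechet_derivative \<phi> (at x) i *\<^sub>R v' x)"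
      by (simp only: eq)
    moreover have "(\<lambda>n. - (LINT x:S|lebesgue. \<phi> x *\<^sub>R g n x))
        \<longlonglongrightarrow> - (LINT x:S|lebesgue. \<phi> x *\<^sub>R g' x)"
      by (rule tendsto_minus)
        (rule integral_against_compact_support_tendsto[OF g G g_lim g_le K(1,2) D(2) K(3)])
    ultimately show "(LINT x:S|lebesgue. frechet_derivative \<phi> (at x) i *\<^sub>R v' x)
        = - (LINT x:S|lebesgue. \<phi> x *\<^sub>R g' x)"
      by (rule LIMSEQ_unique)
  qed
qed

section \<open>Folding a \<open>C^1\<close> map on an open subset\<close>

definition apply_on :: "'a set \<Rightarrow> 'b \<Rightarrow> ('b \<Rightarrow> 'b) \<Rightarrow> ('a \<Rightarrow> 'b) \<Rightarrow> 'a \<Rightarrow> 'b::real_vector" where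
  "apply_on A a T u x = (if x \<in> A then a + T (u x - a) else u x)"

text \<open>The chain rule candidate for the partial derivative of \<open>apply_on A a T u\<close>;
  for the sharp fold it is only a weak one.\<close>

definition apply_on_deriv ::
    "'a set \<Rightarrow> 'b \<Rightarrow> ('b \<Rightarrow> 'b \<Rightarrow> 'b) \<Rightarrow> ('a \<Rightarrow> 'b) \<Rightarrow> 'a \<Rightarrow> 'a::euclidean_space \<Rightarrow> 'b::euclidean_space" where
  "apply_on_deriv A a T' u i x =
     (if x \<in> A then T' (u x - a) (frechet_derivative u (at x) i) else frechet_derivative u (at x) i)"

lemma C1_on_has_derivative:
  "Ck_on 1 S u \<Longrightarrow> x \<in> S \<Longrightarrow> (u has_derivative frechet_derivative u (at x)) (at x)"
  by (simp add: frechet_derivative_works[symmetric])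

lemma C1_on_imp_continuous_on: "Ck_on 1 S u \<Longrightarrow> continuous_on S u"
  by (rule continuous_at_imp_continuous_on)
    (use has_derivative_continuous[OF C1_on_has_derivative] in blast)

lemma C1_on_imp_continuous_on_partial:
  "Ck_on 1 S u \<Longrightarrow> i \<in> Basis \<Longrightarrow> continuous_on S (\<lambda>x. frechet_derivative u (at x) i)"
  by simp

lemma has_vector_derivative_along_line:
  assumes "(f has_derivative f') (at x)"
  shows "((\<lambda>t. f (x + t *\<^sub>R i)) has_vector_derivative f' i) (at 0)"
proof -
  have line: "((\<lambda>t. x + t *\<^sub>R i) has_derivative (\<lambda>t. t *\<^sub>R i)) (at 0)"
    by (auto intro!: derivative_eq_intros)
  have "((\<lambda>t. f (x + t *\<^sub>R i)) has_derivative (\<lambda>t. f' (t *\<^sub>R i))) (at 0)"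
    using has_derivative_compose[OF line, of f f'] assms by simp
  then show ?thesis
    by (simp add: has_vector_derivative_def linear_scale[OF has_derivative_linear[OF assms]])
qed

context
  fixes S A :: "'a::euclidean_space set" and u :: "'a \<Rightarrow> 'b::euclidean_space" and a :: 'b and r :: real
  assumes S: "open S" and A: "open A" "A \<subseteq> S" and u: "Ck_on 1 S u" and r: "0 < r"
    and boundary: "\<forall>x\<in>frontier A \<inter> S. norm (u x - a) \<le> r"
begin

text \<open>Near a point of \<open>frontier A \<inter> S\<close> the values of \<open>u\<close> stay within distance \<open>r + e\<close> of \<open>a\<close>,
  where the smooth fold is the identity.\<close>

lemma smooth_fold_trivial_near_boundary:
  assumes e: "0 < e"
  obtains Q where "open Q" "A \<union> Q = S"
    "\<And>x. x \<in> Q \<Longrightarrow> apply_on A a (smooth_fold r e) u x = u x"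
    "\<And>x i. x \<in> Q \<Longrightarrow>
       apply_on_deriv A a (smooth_fold_deriv r e) u i x = frechet_derivative u (at x) i"
proof
  define P where "P = S \<inter> (\<lambda>x. u x - a) -` ball 0 (r + e)"
  have "open P"
    unfolding P_def using S C1_on_imp_continuous_on[OF u] by (intro continuous_open_preimage continuous_intros) auto
  moreover have "open (S - closure A)" using S by (intro open_Diff) auto
  ultimately show "open (P \<union> (S - closure A))" by (rule open_Un)
  \<comment> \<open>Since \<open>A\<close> is open, such a point lies on its frontier, where
    \<open>u\<close> is within \<open>r < r + e\<close> of \<open>a\<close>.\<close>
  have "x \<in> P" if "x \<in> S" "x \<in> closure A" "x \<notin> A" for x
  proof -
    have "x \<in> frontier A \<inter> S" using that A(1) by (auto simp: frontier_def interior_open)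
    then show ?thesis using boundary[rule_format, of x] e that(1) by (simp add: P_def)
  qed
  moreover have "P \<subseteq> S" by (auto simp: P_def)
  ultimately show "A \<union> (P \<union> (S - closure A)) = S" using A(2) by blast
  have *: "norm (u x - a) \<le> r + e \<or> x \<notin> A" if "x \<in> P \<union> (S - closure A)" for x
    using that closure_subset[of A] by (auto simp: P_def)
  show "apply_on A a (smooth_fold r e) u x = u x" if "x \<in> P \<union> (S - closure A)" for x
    using *[OF that] e r by (auto simp: apply_on_def smooth_fold_near_0)
  show "apply_on_deriv A a (smooth_fold_deriv r e) u i x = frechet_derivative u (at x) i"
    if "x \<in> P \<union> (S - closure A)" for x i
    using *[OF that] e r by (auto simp: apply_on_deriv_def smooth_fold_deriv_near_0)
qed

text \<open>Gluing on the open cover of \<open>S\<close> by \<open>A\<close>, where the map is a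
  composition, and \<open>Q\<close>, where it is \<open>u\<close>.\<close>

lemma continuous_on_apply_smooth_fold:
  assumes e: "0 < e"
  shows "continuous_on S (apply_on A a (smooth_fold r e) u)"
proof -
  obtain Q where Q: "open Q" "A \<union> Q = S" "\<And>x. x \<in> Q \<Longrightarrow> apply_on A a (smooth_fold r e) u x = u x"
    using smooth_fold_trivial_near_boundary[OF e] by metis
  have fold: "continuous_on UNIV (smooth_fold r e :: 'b \<Rightarrow> 'b)"
  proof (rule continuous_at_imp_continuous_on, rule ballI)
    show "isCont (smooth_fold r e) z" for z :: 'b
      by (rule has_derivative_continuous[OF smooth_fold_has_derivative[OF e r]])
  qed
  have "continuous_on A (\<lambda>x. u x - a)"
    by (intro continuous_on_diff continuous_on_const continuous_on_subset[OF C1_on_imp_continuous_on[OF u] A(2)])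
  then have "continuous_on A (\<lambda>x. smooth_fold r e (u x - a))"
    by (rule continuous_on_compose2[OF fold]) simp
  then have "continuous_on A (\<lambda>x. a + smooth_fold r e (u x - a))"
    by (rule continuous_on_add[OF continuous_on_const])
  then have "continuous_on A (apply_on A a (smooth_fold r e) u)"
    by (rule continuous_on_eq) (simp add: apply_on_def)
  moreover have "continuous_on Q u" using C1_on_imp_continuous_on[OF u] by (rule continuous_on_subset) (use Q in auto)
  then have "continuous_on Q (apply_on A a (smooth_fold r e) u)"
    by (rule continuous_on_eq) (simp add: Q)
  ultimately show ?thesis using continuous_on_open_Un[OF A(1) Q(1)] Q(2) by metis
qed

lemma continuous_on_apply_smooth_fold_deriv:
  assumes e: "0 < e" and i: "i \<in> Basis"
  shows "continuous_on S (apply_on_deriv A a (smooth_fold_deriv r e) u i)"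
proof -
  obtain Q where Q: "open Q" "A \<union> Q = S" "\<And>x i. x \<in> Q \<Longrightarrow>
       apply_on_deriv A a (smooth_fold_deriv r e) u i x = frechet_derivative u (at x) i"
    using smooth_fold_trivial_near_boundary[OF e] by metis
  have "continuous_on A (\<lambda>x. smooth_fold_deriv r e (u x - a) (frechet_derivative u (at x) i))"
  proof (rule continuous_on_smooth_fold_deriv[OF e r A(1)])
    show "continuous_on A (\<lambda>x. u x - a)"
      by (intro continuous_on_diff continuous_on_const continuous_on_subset[OF C1_on_imp_continuous_on[OF u] A(2)])
    show "continuous_on A (\<lambda>x. frechet_derivative u (at x) i)"
      by (rule continuous_on_subset[OF C1_on_imp_continuous_on_partial[OF u i] A(2)])
  qed
  then have "continuous_on A (apply_on_deriv A a (smooth_fold_deriv r e) u i)"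
    by (rule continuous_on_eq) (simp add: apply_on_deriv_def)
  moreover have "continuous_on Q (\<lambda>x. frechet_derivative u (at x) i)"
    using C1_on_imp_continuous_on_partial[OF u i] by (rule continuous_on_subset) (use Q in auto)
  then have "continuous_on Q (apply_on_deriv A a (smooth_fold_deriv r e) u i)"
    by (rule continuous_on_eq) (simp add: Q)
  ultimately show ?thesis using continuous_on_open_Un[OF A(1) Q(1)] Q(2) by metis
qed

text \<open>The smoothly folded map is differentiable at every point of \<open>S\<close>: by the
  chain rule on \<open>A\<close>, and on \<open>Q\<close> because it agrees there with
  \<open>u\<close>.\<close>

lemma has_weak_partial_apply_smooth_fold:
  assumes e: "0 < e" and i: "i \<in> Basis"
  shows "has_weak_partial S i (apply_on A a (smooth_fold r e) u)
    (apply_on_deriv A a (smooth_fold_deriv r e) u i)"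
proof (rule has_weak_partial_if_continuous_partial[OF S i continuous_on_apply_smooth_fold[OF e]
      continuous_on_apply_smooth_fold_deriv[OF e i]])
  fix x assume x: "x \<in> S"
  obtain Q where Q: "open Q" "A \<union> Q = S" "\<And>x. x \<in> Q \<Longrightarrow> apply_on A a (smooth_fold r e) u x = u x"
    "\<And>x i. x \<in> Q \<Longrightarrow>
       apply_on_deriv A a (smooth_fold_deriv r e) u i x = frechet_derivative u (at x) i"
    using smooth_fold_trivial_near_boundary[OF e] by metis
  let ?v = "apply_on A a (smooth_fold r e) u"
  show "((\<lambda>t. ?v (x + t *\<^sub>R i)) has_vector_derivative
      apply_on_deriv A a (smooth_fold_deriv r e) u i x) (at 0)"
  proof (cases "x \<in> A")
    case True
    have "((\<lambda>y. u y - a) has_derivative frechet_derivative u (at x)) (at x)"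
      using has_derivative_diff[OF C1_on_has_derivative[OF u x] has_derivative_const[of a]] by simp
    from has_derivative_compose[OF this smooth_fold_has_derivative[OF e r]]
    have "((\<lambda>y. a + smooth_fold r e (u y - a)) has_derivative
        (\<lambda>h. smooth_fold_deriv r e (u x - a) (frechet_derivative u (at x) h))) (at x)"
      by (auto intro!: derivative_eq_intros)
    then have "(?v has_derivative
        (\<lambda>h. smooth_fold_deriv r e (u x - a) (frechet_derivative u (at x) h))) (at x)"
      by (rule has_derivative_transform_within_open[OF _ A(1) True]) (simp add: apply_on_def)
    from has_vector_derivative_along_line[OF this] show ?thesis using True by (simp add: apply_on_deriv_def)
  next
    case False
    then have xQ: "x \<in> Q" using Q(2) x by blast
    have "(?v has_derivative frechet_derivative u (at x)) (at x)"
      by (rule has_derivative_transform_within_open[OF C1_on_has_derivative[OF u x] Q(1) xQ]) (simp add: Q)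
    from has_vector_derivative_along_line[OF this] show ?thesis using Q(4)[OF xQ] by simp
  qed
qed

lemma apply_smooth_fold_tendsto:
  "(\<lambda>n. apply_on A a (smooth_fold r (inverse (real (Suc n)))) u x)
     \<longlonglongrightarrow> apply_on A a (sharp_fold r) u x"
  "(\<lambda>n. apply_on_deriv A a (smooth_fold_deriv r (inverse (real (Suc n)))) u i x)
     \<longlonglongrightarrow> apply_on_deriv A a (sharp_fold_deriv r) u i x"
proof -
  have "filterlim (\<lambda>n. inverse (real (Suc n))) (at_right 0) sequentially"
    unfolding filterlim_at using LIMSEQ_inverse_real_of_nat by auto
  note lim = filterlim_compose[OF smooth_fold_tendsto[OF r] this]
    filterlim_compose[OF smooth_fold_deriv_tendsto[OF r] this]
  show "(\<lambda>n. apply_on A a (smooth_fold r (inverse (real (Suc n)))) u x)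
     \<longlonglongrightarrow> apply_on A a (sharp_fold r) u x"
    unfolding apply_on_def by (cases "x \<in> A") (simp_all add: tendsto_add lim del: of_nat_Suc)
  show "(\<lambda>n. apply_on_deriv A a (smooth_fold_deriv r (inverse (real (Suc n)))) u i x)
     \<longlonglongrightarrow> apply_on_deriv A a (sharp_fold_deriv r) u i x"
    unfolding apply_on_deriv_def by (cases "x \<in> A") (simp_all add: lim del: of_nat_Suc)
qed

text \<open>Smooth folds and their derivatives do not increase norms, so majorants independent of
  \<open>n\<close> can be built from \<open>u\<close> and its partial derivatives; these are
  continuous, hence locally integrable.\<close>

lemma has_weak_partial_apply_sharp_fold:
  assumes i: "i \<in> Basis"
  shows "has_weak_partial S i (apply_on A a (sharp_fold r) u)
    (apply_on_deriv A a (sharp_fold_deriv r) u i)"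
proof (rule has_weak_partial_limit[OF has_weak_partial_apply_smooth_fold[OF _ i] i])
  fix n x
  have pos: "0 < inverse (real (Suc n))" by simp
  then show "0 < inverse (real (Suc n))" .
  show "norm (apply_on A a (smooth_fold r (inverse (real (Suc n)))) u x)
      \<le> norm (u x) + (norm a + norm (u x - a))"
  proof (cases "x \<in> A")
    case True
    have "norm (a + smooth_fold r (inverse (real (Suc n))) (u x - a)) \<le> norm a + norm (u x - a)"
      by (rule norm_triangle_le) (intro add_left_mono norm_smooth_fold_le pos r)
    also have "\<dots> \<le> norm (u x) + (norm a + norm (u x - a))"
      by (rule le_add_same_cancel2[THEN iffD2, OF norm_ge_zero])
    finally show ?thesis unfolding apply_on_def using True by (simp only: if_True)
  next
    case False
    have "norm (u x) \<le> norm (u x) + (norm a + norm (u x - a))" by simp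
    then show ?thesis unfolding apply_on_def using False by (simp only: if_False)
  qed
  show "norm (apply_on_deriv A a (smooth_fold_deriv r (inverse (real (Suc n)))) u i x)
      \<le> norm (frechet_derivative u (at x) i)"
    unfolding apply_on_deriv_def using norm_smooth_fold_deriv_le[OF pos r]
    by (cases "x \<in> A") (simp_all only: if_True if_False order_refl)
next
  show "(\<lambda>x. norm (u x) + (norm a + norm (u x - a))) locally_integrable_on S"
    by (rule locally_integrable_on_continuous)
      (intro continuous_on_add continuous_on_norm continuous_on_diff continuous_on_const C1_on_imp_continuous_on[OF u])
  show "(\<lambda>x. norm (frechet_derivative u (at x) i)) locally_integrable_on S"
    by (rule locally_integrable_on_continuous)
      (intro continuous_on_norm C1_on_imp_continuous_on_partial[OF u i])
qed (rule apply_smooth_fold_tendsto)+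

end

section \<open>Comparison of energies\<close>

lemma set_borel_measurable_continuous_open:
  fixes f :: "'a::euclidean_space \<Rightarrow> 'b::euclidean_space"
  assumes "open S" "continuous_on S f"
  shows "set_borel_measurable lebesgue S f"
proof -
  have "(\<lambda>x. indicator S x *\<^sub>R f x) \<in> borel_measurable lborel"
    using borel_measurable_continuous_on_indicator[OF borel_open[OF assms(1)] assms(2)] by simp
  then show ?thesis
    unfolding set_borel_measurable_def by (rule measurable_completion)
qed

lemma set_borel_measurable_LIMSEQ:
  fixes f :: "nat \<Rightarrow> 'a \<Rightarrow> 'b::euclidean_space"
  assumes f: "\<And>n. set_borel_measurable M S (f n)" and lim: "\<And>x. x \<in> S \<Longrightarrow> (\<lambda>n. f n x) \<longlonglongrightarrow> g x"
  shows "set_borel_measurable M S g"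
  unfolding set_borel_measurable_def
proof (rule borel_measurable_LIMSEQ_metric)
  show "(\<lambda>x. indicator S x *\<^sub>R f n x) \<in> borel_measurable M" for n
    using f[of n] by (simp only: set_borel_measurable_def)
  show "(\<lambda>n. indicator S x *\<^sub>R f n x) \<longlonglongrightarrow> indicator S x *\<^sub>R g x" for x
    using lim[of x] by (cases "x \<in> S") (simp_all add: tendsto_scaleR)
qed

text \<open>The bound is only required almost everywhere because it will involve a weak derivative
  that is known only up to a null set.\<close>

lemma square_integrable_on_bound:
  fixes f :: "'a::euclidean_space \<Rightarrow> 'b::euclidean_space"
  assumes f: "set_borel_measurable lebesgue S f" and w: "set_integrable lebesgue S w"
    and le: "AE x in lebesgue. x \<in> S \<longrightarrow> (norm (f x))\<^sup>2 \<le> w x"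
  shows "f square_integrable_on S"
  unfolding square_integrable_on_def
proof (intro conjI f)
  have *: "indicator S x *\<^sub>R (norm (f x))\<^sup>2 = (norm (indicator S x *\<^sub>R f x))\<^sup>2" for x
    by (cases "x \<in> S") simp_all
  have [measurable]: "(\<lambda>x. indicator S x *\<^sub>R f x) \<in> borel_measurable lebesgue"
    using f by (simp only: set_borel_measurable_def)
  show "set_integrable lebesgue S (\<lambda>x. (norm (f x))\<^sup>2)"
    unfolding set_integrable_def
  proof (rule Bochner_Integration.integrable_bound)
    show "integrable lebesgue (\<lambda>x. indicator S x *\<^sub>R w x)" using w by (simp only: set_integrable_def)
    show "(\<lambda>x. indicator S x *\<^sub>R (norm (f x))\<^sup>2) \<in> borel_measurable lebesgue"
      unfolding * by measurable
    show "AE x in lebesgue. norm (indicator S x *\<^sub>R (norm (f x))\<^sup>2) \<le> norm (indicator S x *\<^sub>R w x)"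
      using le
    proof (rule eventually_mono)
      fix x assume "x \<in> S \<longrightarrow> (norm (f x))\<^sup>2 \<le> w x"
      then show "norm (indicator S x *\<^sub>R (norm (f x))\<^sup>2) \<le> norm (indicator S x *\<^sub>R w x)"
        using zero_le_power2[of "norm (f x)"] by (cases "x \<in> S") simp_all
    qed
  qed
qed

text \<open>The choice operator returns some weak derivative as soon as one exists, and uniqueness
  identifies it with \<open>g\<close>.\<close>

lemma weak_partial_AE_eq:
  fixes g v :: "'a::euclidean_space \<Rightarrow> 'b::euclidean_space"
  assumes S: "open S" and g: "has_weak_partial S i v g"
  shows "AE x in lebesgue. x \<in> S \<longrightarrow> weak_partial S i v x = g x"
proof -
  have "has_weak_partial S i v (weak_partial S i v)"
    unfolding weak_partial_def by (rule someI[of "has_weak_partial S i v", OF g])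
  from weak_partial_unique[OF S this g] show ?thesis .
qed

lemma energy_eq:
  fixes v :: "'a::euclidean_space \<Rightarrow> 'b::euclidean_space"
  assumes S: "open S" and G: "\<And>i. i \<in> Basis \<Longrightarrow> has_weak_partial S i v (G i)"
  shows "energy W S v =
    (\<integral>\<^sup>+x\<in>S. ennreal (1/2 * (\<Sum>i\<in>Basis. (norm (G i x))\<^sup>2) + W (v x)) \<partial>lebesgue)"
  unfolding energy_def
proof (rule nn_integral_cong_AE)
  have "AE x in lebesgue. \<forall>i\<in>(Basis :: 'a set). x \<in> S \<longrightarrow> weak_partial S i v x = G i x"
    by (rule AE_finite_allI) (auto intro: weak_partial_AE_eq S G)
  then show "AE x in lebesgue.
      ennreal (1/2 * (\<Sum>i\<in>Basis. (norm (weak_partial S i v x))\<^sup>2) + W (v x)) * indicator S x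
      = ennreal (1/2 * (\<Sum>i\<in>Basis. (norm (G i x))\<^sup>2) + W (v x)) * indicator S x"
  proof (rule eventually_mono)
    fix x assume eq: "\<forall>i\<in>(Basis :: 'a set). x \<in> S \<longrightarrow> weak_partial S i v x = G i x"
    show "ennreal (1/2 * (\<Sum>i\<in>Basis. (norm (weak_partial S i v x))\<^sup>2) + W (v x)) * indicator S x
      = ennreal (1/2 * (\<Sum>i\<in>Basis. (norm (G i x))\<^sup>2) + W (v x)) * indicator S x"
    proof (cases "x \<in> S")
      case True
      then have "(\<Sum>i\<in>Basis. (norm (weak_partial S i v x))\<^sup>2) = (\<Sum>i\<in>Basis. (norm (G i x))\<^sup>2)"
        using eq by (intro sum.cong) auto
      then show ?thesis by (simp only:)
    qed simp
  qed
qed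

lemma energy_density_measurable:
  fixes v :: "'a::euclidean_space \<Rightarrow> 'b::euclidean_space"
  assumes W: "continuous_on UNIV W" and S: "open S" and v: "set_borel_measurable lebesgue S v"
    and G: "\<And>i. i \<in> Basis \<Longrightarrow> set_borel_measurable lebesgue S (G i :: 'a \<Rightarrow> 'b)"
  shows "(\<lambda>x. ennreal (1/2 * (\<Sum>i\<in>Basis. (norm (G i x))\<^sup>2) + W (v x)) * indicator S x)
    \<in> borel_measurable lebesgue"
proof -
  have [measurable]: "(\<lambda>x. indicator S x *\<^sub>R v x) \<in> borel_measurable lebesgue"
    using v by (simp only: set_borel_measurable_def)
  have G' [measurable]: "(\<lambda>x. indicator S x *\<^sub>R G i x) \<in> borel_measurable lebesgue" if "i \<in> Basis" for i
    using G[OF that] by (simp only: set_borel_measurable_def)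
  have [measurable]: "S \<in> sets lebesgue" using S by auto
  have [measurable]: "W \<in> borel_measurable borel" using W by (rule borel_measurable_continuous_onI)
  \<comment> \<open>Measurability is known only for the functions cut off to \<open>S\<close>; the
    outer indicator removes the effect of the cut-off.\<close>
  have "(\<lambda>x. ennreal (1/2 * (\<Sum>i\<in>Basis. (norm (indicator S x *\<^sub>R G i x))\<^sup>2)
      + W (indicator S x *\<^sub>R v x)) * indicator S x) \<in> borel_measurable lebesgue"
    by measurable
  moreover have "ennreal (1/2 * (\<Sum>i\<in>Basis. (norm (indicator S x *\<^sub>R G i x))\<^sup>2)
      + W (indicator S x *\<^sub>R v x)) * indicator S x =
      ennreal (1/2 * (\<Sum>i\<in>Basis. (norm (G i x))\<^sup>2) + W (v x)) * indicator S x" for x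
    by (cases "x \<in> S") simp_all
  ultimately show ?thesis by simp
qed

text \<open>The densities are ordered on \<open>S\<close> and differ strictly on \<open>N\<close>,
  which has positive measure because it is open and nonempty.\<close>

lemma energy_less:
  fixes v w :: "'a::euclidean_space \<Rightarrow> 'b::euclidean_space"
  assumes S: "open S" and W: "continuous_on UNIV W" "\<And>y. 0 \<le> W y"
    and v: "\<And>i. i \<in> Basis \<Longrightarrow> has_weak_partial S i v (G i)" "set_borel_measurable lebesgue S v"
      "\<And>i. i \<in> Basis \<Longrightarrow> set_borel_measurable lebesgue S (G i)"
    and w: "\<And>i. i \<in> Basis \<Longrightarrow> has_weak_partial S i w (H i)" "set_borel_measurable lebesgue S w"
      "\<And>i. i \<in> Basis \<Longrightarrow> set_borel_measurable lebesgue S (H i)"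
    and fin: "energy W S w < \<infinity>"
    and G_le: "\<And>i x. i \<in> Basis \<Longrightarrow> x \<in> S \<Longrightarrow> norm (G i x) \<le> norm (H i x)"
    and W_le: "\<And>x. x \<in> S \<Longrightarrow> W (v x) \<le> W (w x)"
    and N: "open N" "N \<noteq> {}" "N \<subseteq> S" and W_less: "\<And>x. x \<in> N \<Longrightarrow> W (v x) < W (w x)"
  shows "energy W S v < energy W S w"
proof -
  define e where "e = (\<lambda>(D :: 'a \<Rightarrow> 'a \<Rightarrow> 'b) v x. 1/2 * (\<Sum>i\<in>Basis. (norm (D i x))\<^sup>2) + W (v x))"
  have energy: "energy W S v = (\<integral>\<^sup>+x. ennreal (e G v x) * indicator S x \<partial>lebesgue)"
    "energy W S w = (\<integral>\<^sup>+x. ennreal (e H w x) * indicator S x \<partial>lebesgue)"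
    unfolding e_def using energy_eq[OF S v(1)] energy_eq[OF S w(1)] by blast+
  have e_nonneg: "0 \<le> e D v x" for D v x
    unfolding e_def using W(2)[of "v x"] by (simp add: sum_nonneg)
  have sum_le: "(\<Sum>i\<in>Basis. (norm (G i x))\<^sup>2) \<le> (\<Sum>i\<in>Basis. (norm (H i x))\<^sup>2)" if "x \<in> S" for x
    using that G_le by (intro sum_mono power_mono) auto
  have le: "e G v x \<le> e H w x" if "x \<in> S" for x
    using sum_le[OF that] W_le[OF that] unfolding e_def by linarith
  have less: "e G v x < e H w x" if "x \<in> N" for x
    using sum_le[of x] W_less[OF that] N(3) that unfolding e_def by (intro add_le_less_mono) auto
  have le_all: "ennreal (e G v x) * indicator S x \<le> ennreal (e H w x) * indicator S x" for x
    using le[of x] by (cases "x \<in> S") (simp_all add: ennreal_leI)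
  show ?thesis
    unfolding energy
  proof (rule nn_integral_less)
    show "(\<lambda>x. ennreal (e G v x) * indicator S x) \<in> borel_measurable lebesgue"
      unfolding e_def by (rule energy_density_measurable[OF W(1) S v(2,3)])
    show "(\<lambda>x. ennreal (e H w x) * indicator S x) \<in> borel_measurable lebesgue"
      unfolding e_def by (rule energy_density_measurable[OF W(1) S w(2,3)])
    have "(\<integral>\<^sup>+x. ennreal (e G v x) * indicator S x \<partial>lebesgue) \<le> energy W S w"
      unfolding energy by (rule nn_integral_mono) (rule le_all)
    \<comment> \<open>Strict inequality of the integrals requires the smaller one to be finite; it
      inherits this from \<open>w\<close>.\<close>
    then show "(\<integral>\<^sup>+x. ennreal (e G v x) * indicator S x \<partial>lebesgue) \<noteq> \<infinity>"
      using fin by (metis infinity_ennreal_def top.extremum_uniqueI less_irrefl)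
    show "AE x in lebesgue. ennreal (e G v x) * indicator S x \<le> ennreal (e H w x) * indicator S x"
      using le_all by (intro always_eventually allI)
    show "\<not> (AE x in lebesgue. ennreal (e H w x) * indicator S x \<le> ennreal (e G v x) * indicator S x)"
    proof
      assume "AE x in lebesgue. ennreal (e H w x) * indicator S x \<le> ennreal (e G v x) * indicator S x"
      then have "AE x in lebesgue. x \<notin> N"
      proof (rule eventually_mono, intro notI)
        fix x assume x: "x \<in> N"
          and *: "ennreal (e H w x) * indicator S x \<le> ennreal (e G v x) * indicator S x"
        have "x \<in> S" using x N(3) by blast
        then have "e H w x \<le> e G v x" using * e_nonneg[of G v x] by (simp add: ennreal_le_iff)
        with less[OF x] show False by simp
      qed
      then have "N \<in> null_sets lebesgue" using AE_iff_null_sets[of N lebesgue] N(1) by auto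
      then have "negligible N" by (simp only: negligible_iff_null_sets)
      with N(1,2) show False using open_not_negligible by metis
    qed
  qed
qed

text \<open>The three zones of the fold: the value is kept, reflected along its ray to a smaller
  distance from \<open>a\<close> where radial monotonicity applies, or sent to the global minimum
  \<open>a\<close>.\<close>

lemma potential_sharp_fold:
  fixes W :: "'a::euclidean_space \<Rightarrow> real"
  assumes radial: "\<And>w. norm w = 1 \<Longrightarrow> strict_mono_on {0..<r\<^sub>0} (\<lambda>t. W (a + t *\<^sub>R w))"
    and a_min: "\<And>w. W a \<le> W w" and r: "0 < 2 * r" "2 * r < r\<^sub>0"
  shows "W (a + sharp_fold r z) \<le> W (a + z)"
    and "r < norm z \<Longrightarrow> norm z < 2 * r \<Longrightarrow> W (a + sharp_fold r z) < W (a + z)"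
proof -
  have less: "W (a + sharp_fold r z) < W (a + z)" if "r < norm z" "norm z \<le> 2 * r"
  proof -
    have "z \<noteq> 0" using that r by auto
    then have "norm (sgn z) = 1" by (simp add: norm_sgn)
    \<comment> \<open>Here
      \<open>0 \<le> 2 * r - norm z < norm z \<le> 2 * r < r\<^sub>0\<close>.\<close>
    then have "W (a + (2 * r - norm z) *\<^sub>R sgn z) < W (a + norm z *\<^sub>R sgn z)"
      by (rule strict_mono_onD[OF radial]) (use that r in auto)
    moreover have "sharp_fold r z = (2 * r - norm z) *\<^sub>R sgn z"
      using that by (simp add: sharp_fold_def sharp_scale_def sgn_div_norm divide_inverse)
    moreover have "norm z *\<^sub>R sgn z = z" using \<open>z \<noteq> 0\<close> by (simp add: sgn_div_norm)
    ultimately show ?thesis by (simp only:)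
  qed
  then show "r < norm z \<Longrightarrow> norm z < 2 * r \<Longrightarrow> W (a + sharp_fold r z) < W (a + z)" by simp
  show "W (a + sharp_fold r z) \<le> W (a + z)"
  proof (cases "norm z \<le> r \<or> 2 * r < norm z")
    case True
    then show ?thesis using a_min r by (auto simp: sharp_fold_def sharp_scale_def)
  next
    case False
    then show ?thesis using less by simp
  qed
qed

text \<open>Without intermediate values, \<open>r < \<rho>\<close> and \<open>s \<le> \<rho>\<close>
  cut out the same set \<open>G\<close> in \<open>A\<close>. The first form shows that
  \<open>G\<close> is open, the second that the rest of \<open>S\<close> is; connectedness then
  forces \<open>G = S\<close>, against the proper inclusion of \<open>A\<close>.\<close>

lemma intermediate_region_nonempty:
  fixes S A :: "'a::topological_space set" and \<rho> :: "'a \<Rightarrow> real"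
  assumes S: "open S" "connected S" and A: "open A" "A \<subset> S" and \<rho>: "continuous_on S \<rho>"
    and boundary: "\<And>x. x \<in> frontier A \<inter> S \<Longrightarrow> \<rho> x \<le> r" and rs: "r < s"
    and x: "x \<in> A" "r < \<rho> x"
  shows "\<exists>y\<in>A. r < \<rho> y \<and> \<rho> y < s"
proof (rule ccontr)
  assume none: "\<not> (\<exists>y\<in>A. r < \<rho> y \<and> \<rho> y < s)"
  define G where "G = {y \<in> A. r < \<rho> y}"
  have G_eq: "G = {y \<in> A. s \<le> \<rho> y}" using none rs by (auto simp: G_def not_less)
  have "open (S \<inter> \<rho> -` {r<..})" by (rule continuous_open_preimage[OF \<rho> S(1) open_greaterThan])
  moreover have "G = A \<inter> (S \<inter> \<rho> -` {r<..})" using A(2) by (auto simp: G_def)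
  ultimately have "open G" using A(1) by auto
  have "open (S \<inter> \<rho> -` {..<s})" by (rule continuous_open_preimage[OF \<rho> S(1) open_lessThan])
  moreover have "open (S - closure A)" using S(1) by (intro open_Diff) auto
  \<comment> \<open>This open set contains the frontier points of \<open>A\<close> in
    \<open>S\<close>, as \<rho> is at most \<open>r < s\<close> there.\<close>
  ultimately have "open ((S \<inter> \<rho> -` {..<s}) \<union> (S - closure A))" by (rule open_Un)
  moreover have "G \<inter> ((S \<inter> \<rho> -` {..<s}) \<union> (S - closure A)) \<inter> S = {}"
    using closure_subset[of A] by (auto simp: G_eq)
  moreover have "y \<in> G \<union> ((S \<inter> \<rho> -` {..<s}) \<union> (S - closure A))" if "y \<in> S" for y
  proof (cases "y \<in> A")
    case True
    then show ?thesis using that by (auto simp: G_eq not_le)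
  next
    case False
    show ?thesis
    proof (cases "y \<in> closure A")
      case True
      then have "y \<in> frontier A \<inter> S" using False that A(1) by (simp add: frontier_def interior_open)
      then show ?thesis using boundary[of y] rs that by auto
    qed (use that in auto)
  qed
  then have "S \<subseteq> G \<union> ((S \<inter> \<rho> -` {..<s}) \<union> (S - closure A))" by blast
  moreover have "G \<inter> S \<noteq> {}" using x A(2) by (auto simp: G_def)
  ultimately have "((S \<inter> \<rho> -` {..<s}) \<union> (S - closure A)) \<inter> S = {}"
    using S(2) \<open>open G\<close> unfolding connected_def by blast
  then have "S \<subseteq> G" using \<open>S \<subseteq> G \<union> _\<close> by blast
  then show False using A(2) by (auto simp: G_def)
qed

section \<open>The folded map as a competitor of smaller energy\<close>

text \<open>The inclusion of \<open>A\<close> is proper: for \<open>A = \<Omega>\<close> a constant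
  map onto a zero of \<open>W\<close> farther than \<open>r\<close> from \<open>a\<close> would have
  energy 0. Finite energy of \<open>u\<close> is assumed because \<open>energy\<close> may be
  infinite, and a change on \<open>A\<close> alone might not remedy that.\<close>

theorem mainTheorem1:
  fixes \<Omega> A :: "(real ^ 'n) set"
    and W :: "real ^ 'm \<Rightarrow> real"
    and a :: "real ^ 'm"
    and u :: "real ^ 'n \<Rightarrow> real ^ 'm"
    and r r\<^sub>0 :: real
    and x\<^sub>0 :: "real ^ 'n"
  assumes Omega: "bounded \<Omega>" "open \<Omega>" "connected \<Omega>" "lipschitz_boundary \<Omega>"
    and W_nonneg: "\<And>w. 0 \<le> W w"
    and W_C1: "Ck_on 1 UNIV W"
    and W_several_minima: "\<exists>b c. b \<noteq> c \<and> local_minimum W b \<and> local_minimum W c"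
    and a_min: "\<And>w. W a \<le> W w"
    and r0_pos: "0 < r\<^sub>0"
    and W_radial: "\<And>w. norm w = 1 \<Longrightarrow> strict_mono_on {0..<r\<^sub>0} (\<lambda>t. W (a + t *\<^sub>R w))"
    and A: "A \<subset> \<Omega>" "open A" "lipschitz_boundary A" "frontier A \<noteq> {}"
    and u_W12: "u \<in> sobolev_W12 \<Omega>"
    and u_C1: "Ck_on 1 \<Omega> u"
    and u_finite_energy: "energy W \<Omega> u < \<infinity>"
    and r: "0 < 2 * r" "2 * r < r\<^sub>0"
    and u_boundary: "\<And>x. x \<in> frontier A \<inter> \<Omega> \<Longrightarrow> norm (u x - a) \<le> r"
    and x0: "x\<^sub>0 \<in> A" "norm (u x\<^sub>0 - a) > r"
  shows "\<exists>u' :: real ^ 'n \<Rightarrow> real ^ 'm.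
           u' \<in> sobolev_W12 \<Omega> \<and>
           (\<forall>x \<in> \<Omega> - A. u' x = u x) \<and>
           (\<forall>x \<in> A. norm (u' x - a) \<le> r) \<and>
           energy W \<Omega> u' < energy W \<Omega> u"
proof (intro exI conjI ballI)
  let ?u' = "apply_on A a (sharp_fold r) u"
  define G where "G = apply_on_deriv A a (sharp_fold_deriv r) u"
  define H where "H = (\<lambda>i x. frechet_derivative u (at x) i)"
  have r0: "0 < r" using r by simp
  have boundary: "\<forall>x\<in>frontier A \<inter> \<Omega>. norm (u x - a) \<le> r" using u_boundary by blast
  \<comment> \<open>These discharge the assumptions of the context on folded maps, in their
    order.\<close>
  note hyps = Omega(2) A(2) psubset_imp_subset[OF A(1)] u_C1 r0 boundary
  note cont_u = C1_on_imp_continuous_on[OF u_C1]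
  have cont_H: "continuous_on \<Omega> (H i)" if "i \<in> Basis" for i
    unfolding H_def by (rule C1_on_imp_continuous_on_partial[OF u_C1 that])
  have G_le: "norm (G i x) \<le> norm (H i x)" for i x
    unfolding G_def H_def apply_on_deriv_def 
    using norm_sharp_fold_deriv_le[OF r0, of "u x - a" "frechet_derivative u (at x) i"] by simp
  have u'_A: "norm (?u' x - a) \<le> r" if "x \<in> A" for x
    using norm_sharp_fold_le[OF r0, of "u x - a"] that by (simp add: apply_on_def)
  have weak_u: "has_weak_partial \<Omega> i u (H i)" if i: "i \<in> Basis" for i
    unfolding H_def
    by (rule has_weak_partial_if_continuous_partial[OF Omega(2) i cont_u
          C1_on_imp_continuous_on_partial[OF u_C1 i]])
      (rule has_vector_derivative_along_line[OF C1_on_has_derivative[OF u_C1]])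
  have weak_u': "has_weak_partial \<Omega> i ?u' (G i)" if i: "i \<in> Basis" for i
    unfolding G_def by (rule has_weak_partial_apply_sharp_fold[OF hyps i])
  have meas_u: "set_borel_measurable lebesgue \<Omega> u"
    by (rule set_borel_measurable_continuous_open[OF Omega(2) cont_u])
  have meas_H: "set_borel_measurable lebesgue \<Omega> (H i)" if i: "i \<in> Basis" for i
    by (rule set_borel_measurable_continuous_open[OF Omega(2) cont_H[OF i]])
  have pos: "0 < inverse (real (Suc n))" for n by simp
  \<comment> \<open>The sharply folded map is a pointwise limit of continuous, smoothly folded
    ones.\<close>
  have meas_u': "set_borel_measurable lebesgue \<Omega> ?u'"
    by (rule set_borel_measurable_LIMSEQ[OF
        set_borel_measurable_continuous_open[OF Omega(2) continuous_on_apply_smooth_fold[OF hyps pos]]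
        apply_smooth_fold_tendsto(1)[OF hyps]])
  have meas_G: "set_borel_measurable lebesgue \<Omega> (G i)" if i: "i \<in> Basis" for i
    unfolding G_def
    by (rule set_borel_measurable_LIMSEQ[OF
        set_borel_measurable_continuous_open[OF Omega(2) continuous_on_apply_smooth_fold_deriv[OF hyps pos i]]
        apply_smooth_fold_tendsto(2)[OF hyps]])
  show "?u' \<in> sobolev_W12 \<Omega>"
    unfolding sobolev_W12_def
  proof (intro CollectI conjI ballI)
    have "set_integrable lebesgue \<Omega> (\<lambda>x. (norm (u x))\<^sup>2)"
      using u_W12 by (simp add: sobolev_W12_def square_integrable_on_def)
    \<comment> \<open>Constants are integrable because \<open>\<Omega>\<close> is bounded.\<close>
    moreover have "set_integrable lebesgue \<Omega> (\<lambda>x. (r + norm a)\<^sup>2)"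
    proof (rule set_integrable_subset)
      show "set_integrable lebesgue (closure \<Omega>) (\<lambda>x. (r + norm a)\<^sup>2)"
        by (rule set_integrable_continuous_compact) (use Omega(1) in \<open>simp_all add: compact_closure\<close>)
    qed (use Omega(2) closure_subset in auto)
    ultimately have "set_integrable lebesgue \<Omega> (\<lambda>x. (norm (u x))\<^sup>2 + (r + norm a)\<^sup>2)"
      by (rule set_integral_add(1))
    moreover have "(norm (?u' x))\<^sup>2 \<le> (norm (u x))\<^sup>2 + (r + norm a)\<^sup>2" for x
    proof (cases "x \<in> A")
      case True
      have "norm (?u' x) \<le> r + norm a"
        using norm_triangle_le[of "?u' x - a" a "r + norm a"] u'_A[OF True] by simp
      then have "(norm (?u' x))\<^sup>2 \<le> (r + norm a)\<^sup>2" by (rule power_mono) simp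
      then show ?thesis using zero_le_power2[of "norm (u x)"] by linarith
    next
      case False
      then show ?thesis by (simp add: apply_on_def)
    qed
    ultimately show "?u' square_integrable_on \<Omega>"
      by (intro square_integrable_on_bound[OF meas_u']) auto
    fix i :: "real ^ 'n" assume i: "i \<in> Basis"
    \<comment> \<open>Square integrability is given for some weak derivative \<open>g\<close>;
      uniqueness transfers it to the classical one, which dominates \<open>G i\<close>.\<close>
    obtain g where g: "g square_integrable_on \<Omega>" "has_weak_partial \<Omega> i u g"
      using u_W12 i by (auto simp: sobolev_W12_def)
    have "AE x in lebesgue. x \<in> \<Omega> \<longrightarrow> (norm (G i x))\<^sup>2 \<le> (norm (g x))\<^sup>2"
      using weak_partial_unique[OF Omega(2) g(2) weak_u[OF i]]
    proof (rule eventually_mono, intro impI)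
      fix x assume "x \<in> \<Omega> \<longrightarrow> g x = H i x" "x \<in> \<Omega>"
      then show "(norm (G i x))\<^sup>2 \<le> (norm (g x))\<^sup>2" using G_le[of i x] by (simp add: power_mono)
    qed
    moreover have "set_integrable lebesgue \<Omega> (\<lambda>x. (norm (g x))\<^sup>2)"
      using g(1) by (simp add: square_integrable_on_def)
    ultimately have "G i square_integrable_on \<Omega>"
      by (intro square_integrable_on_bound[OF meas_G[OF i]])
    then show "\<exists>g. g square_integrable_on \<Omega> \<and> has_weak_partial \<Omega> i ?u' g"
      using weak_u'[OF i] by blast
  qed
  show "?u' x = u x" if "x \<in> \<Omega> - A" for x using that by (simp add: apply_on_def)
  show "norm (?u' x - a) \<le> r" if "x \<in> A" for x using that by (rule u'_A)
  \<comment> \<open>The open part of \<open>A\<close> on which the fold reflects values and thus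
    strictly lowers the potential.\<close>
  define N where "N = A \<inter> (\<Omega> \<inter> (\<lambda>x. norm (u x - a)) -` {r<..<2 * r})"
  have cont_\<rho>: "continuous_on \<Omega> (\<lambda>x. norm (u x - a))"
    by (intro continuous_on_norm continuous_on_diff continuous_on_const cont_u)
  show "energy W \<Omega> ?u' < energy W \<Omega> u"
  proof (rule energy_less[OF Omega(2) _ W_nonneg weak_u' meas_u' meas_G weak_u meas_u meas_H u_finite_energy])
    show "continuous_on UNIV W" by (rule C1_on_imp_continuous_on[OF W_C1])
    show "norm (G i x) \<le> norm (H i x)" for i x by (rule G_le)
    show "W (?u' x) \<le> W (u x)" for x
      using potential_sharp_fold(1)[OF W_radial a_min r, of "u x - a"] by (simp add: apply_on_def)
    have "open (\<Omega> \<inter> (\<lambda>x. norm (u x - a)) -` {r<..<2 * r})"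
      by (rule continuous_open_preimage[OF cont_\<rho> Omega(2) open_greaterThanLessThan])
    then show "open N" using A(2) by (simp add: N_def open_Int)
    have "\<exists>y\<in>A. r < norm (u y - a) \<and> norm (u y - a) < 2 * r"
      by (rule intermediate_region_nonempty[OF Omega(2,3) A(2,1) cont_\<rho> u_boundary _ x0]) (use r in auto)
    then show "N \<noteq> {}" using A(1) by (auto simp: N_def)
    show "N \<subseteq> \<Omega>" by (auto simp: N_def)
    show "W (?u' x) < W (u x)" if "x \<in> N" for x
      using potential_sharp_fold(2)[OF W_radial a_min r, of "u x - a"] that
      by (simp add: apply_on_def N_def)
  qed
qed

end
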